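(* Let $\mathbf{k}$ be a field (of any characteristic) and $B$ a $\mathbf{k}$-domain such that $\operatorname{trdeg}_{\mathbf{k}}(B)<\infty$ and $|\mathcal{A}_1^*(B)|>1$. Then the following hold. (a) For each $A\in\mathcal{A}_1^*(B)$, we have $\mathbf{k}\subseteq A$ and $\operatorname{Frac}(A)$ is ruled over $\mathbf{k}$. (b) There exists a field $K$ satisfying $\mathbf{k}\subseteq K\subseteq\operatorname{Frac} B$ and $\operatorname{Frac} B=K^{(2)}$.
   Context: All rings are commutative with unity; "domain" means integral domain. A $\mathbf{k}$-domain is a domain that is a $\mathbf{k}$-algebra; $\operatorname{trdeg}_{\mathbf{k}}(B)$ is the transcendence degree of $\operatorname{Frac} B$ over $\mathbf{k}$. For a domain $B$, $\mathcal{A}_1^*(B)$ is the set of subrings $A$ of $B$ such that $A$ is algebraically closed in $B$ and, with $S=A\setminus\{0\}$, the ring $S^{-1}B$ is a polynomial ring in one variable over the field $S^{-1}A=\operatorname{Frac} A$. For fields, $L=K^{(n)}$ means that $L$ is a purely transcendental extension of $K$ of transcendence degree $n$. A field extension $L/E$ is ruled ($L$ is ruled over $E$) if there is a field $F$ with $E\subseteq F\subseteq L$ and $L=F^{(1)}$. *)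

theory Defs
  imports
    "HOL.Hull"
    "HOL-Library.Extended_Nat"
    "HOL-Library.Poly_Mapping"
    "HOL-Computational_Algebra.Computational_Algebra"
begin

text \<open>
  A domain \<open>B\<close> is a type \<open>'b :: idom\<close>, its fraction field is the library type \<open>'b fract\<close>,
  and \<open>B\<close> embeds in it by \<^const>\<open>to_fract\<close>. Subrings of \<open>B\<close> and subfields of \<open>Frac B\<close> are sets.
\<close>

definition is_subring :: "'a :: comm_ring_1 set \<Rightarrow> bool" where
  "is_subring A \<longleftrightarrow> 1 \<in> A \<and> (\<forall>x\<in>A. \<forall>y\<in>A. x - y \<in> A \<and> x * y \<in> A)"

definition is_subfield :: "'a :: field set \<Rightarrow> bool" where
  "is_subfield K \<longleftrightarrow> is_subring K \<and> (\<forall>x\<in>K. inverse x \<in> K)"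

definition algebraic_over :: "'a :: comm_ring_1 set \<Rightarrow> 'a \<Rightarrow> bool" where
  "algebraic_over A x \<longleftrightarrow> (\<exists>p. p \<noteq> 0 \<and> (\<forall>i. coeff p i \<in> A) \<and> poly p x = 0)"

definition algebraically_closed_in :: "'a :: comm_ring_1 set \<Rightarrow> 'a set \<Rightarrow> bool" where
  "algebraically_closed_in A B \<longleftrightarrow> (\<forall>x\<in>B. algebraic_over A x \<longrightarrow> x \<in> A)"

text \<open>\<open>R = K[t]\<close> with \<open>t\<close> transcendental over \<open>K\<close>.\<close>

definition is_poly_ring_over :: "'a :: comm_ring_1 set \<Rightarrow> 'a set \<Rightarrow> bool" where
  "is_poly_ring_over K R \<longleftrightarrow>
     (\<exists>t. \<not> algebraic_over K t \<and> R = {poly p t | p. \<forall>i. coeff p i \<in> K})"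

text \<open>
  \<open>S\<^sup>-\<^sup>1 M\<close> as a subset of \<open>Frac B\<close>; only meaningful for \<open>0 \<notin> S\<close>.
\<close>

definition fractions :: "'b :: idom set \<Rightarrow> 'b set \<Rightarrow> 'b fract set" where
  "fractions S M = {to_fract m / to_fract s | m s. m \<in> M \<and> s \<in> S}"

text \<open>\<open>Frac A\<close>, realised inside \<open>Frac B\<close>.\<close>

definition Frac :: "'b :: idom set \<Rightarrow> 'b fract set" where
  "Frac A = fractions (A - {0}) A"

definition A1_star :: "'b :: idom set set" where
  "A1_star = {A. is_subring A \<and> algebraically_closed_in A UNIV \<and>
                 is_poly_ring_over (Frac A) (fractions (A - {0}) UNIV)}"

text \<open>
  A polynomial whose variables are elements of \<open>'a\<close> is a finitely supported map from monomials
  (finitely supported exponent vectors) to coefficients; every variable is evaluated at itself.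
\<close>

definition eval_mpoly :: "(('a \<Rightarrow>\<^sub>0 nat) \<Rightarrow>\<^sub>0 'a) \<Rightarrow> 'a :: comm_ring_1" where
  "eval_mpoly p =
     (\<Sum>m\<in>Poly_Mapping.keys p. Poly_Mapping.lookup p m *
        (\<Prod>x\<in>Poly_Mapping.keys m. x ^ Poly_Mapping.lookup m x))"

definition alg_independent :: "'a :: comm_ring_1 set \<Rightarrow> 'a set \<Rightarrow> bool" where
  "alg_independent K X \<longleftrightarrow>
     (\<forall>p. (\<forall>m. Poly_Mapping.lookup p m \<in> K) \<and>
          (\<forall>m\<in>Poly_Mapping.keys p. Poly_Mapping.keys m \<subseteq> X) \<and>
          eval_mpoly p = 0 \<longrightarrow> p = 0)"

definition field_adjoin :: "'a :: field set \<Rightarrow> 'a set \<Rightarrow> 'a set" where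
  "field_adjoin K X = is_subfield hull (K \<union> X)"

definition transcendence_basis :: "'a :: field set \<Rightarrow> 'a set \<Rightarrow> 'a set \<Rightarrow> bool" where
  "transcendence_basis K L X \<longleftrightarrow>
     X \<subseteq> L \<and> alg_independent K X \<and> (\<forall>y\<in>L. algebraic_over (field_adjoin K X) y)"

text \<open>
  The common cardinality of all transcendence bases, with all infinite cardinals identified.
  The infimum selects this common value.
\<close>

definition trdeg :: "'a :: field set \<Rightarrow> 'a set \<Rightarrow> enat" where
  "trdeg K L =
     (INF X\<in>{X. transcendence_basis K L X}. if finite X then enat (card X) else \<infinity>)"

text \<open>\<open>L = K\<^sup>(\<^sup>n\<^sup>)\<close>\<close>

definition purely_transcendental :: "'a :: field set \<Rightarrow> nat \<Rightarrow> 'a set \<Rightarrow> bool" where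
  "purely_transcendental K n L \<longleftrightarrow>
     (\<exists>X. finite X \<and> card X = n \<and> alg_independent K X \<and> L = field_adjoin K X)"

definition ruled_over :: "'a :: field set \<Rightarrow> 'a set \<Rightarrow> bool" where
  "ruled_over E L \<longleftrightarrow>
     (\<exists>F. is_subfield F \<and> E \<subseteq> F \<and> F \<subseteq> L \<and> purely_transcendental F 1 L)"

end

theory Submission
  imports Defs
begin

text \<open>
  Let \<open>A\<close> and \<open>A'\<close> be distinct members of \<open>A1_star\<close>, put \<open>K = Frac A\<close>, \<open>K' = Frac A'\<close>, \<open>L = Frac B\<close>,
  and write \<open>L = K(t) = K'(t')\<close> with \<open>B \<subseteq> K[t]\<close>. A nonzero element of the ground field \<open>k\<close> is a unit of
  \<open>B\<close>, hence a unit of \<open>K[t]\<close>, hence in \<open>K\<close>; so it is algebraic over \<open>A\<close> and lies in \<open>A\<close>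
  (\<open>unit_mem_A1_star\<close>).

  No member of \<open>A1_star\<close> properly contains another (\<open>A1_star_antisym\<close>), so there is \<open>a \<in> A'\<close> outside \<open>A\<close>;
  it is a polynomial in \<open>t\<close> over \<open>K\<close> of positive degree. The place of \<open>L\<close> at \<open>t = \<infinity>\<close> is trivial on
  \<open>K\<close>, has residue field \<open>K\<close>, and sends \<open>1/a \<in> K'\<close> to \<open>0\<close>. Being nontrivial on \<open>K'\<close>, it drops the
  transcendence degree of \<open>K'\<close>: the residue field \<open>\<kappa>'\<close> of \<open>K'\<close> has smaller transcendence degree over
  \<open>k\<close> than \<open>K'\<close>, which has the same one as \<open>K\<close>. These degrees are finite, so \<open>K\<close> is not algebraic
  over \<open>\<kappa>'\<close> (\<open>residue_field_not_algebraic\<close>).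

  This is the situation of the ruled residue theorem of Nagata and Ohm (\<open>ruled_residue_field\<close>): if a
  place of \<open>K'(t')\<close> has a residue that is transcendental over the residue field \<open>\<kappa>'\<close> of \<open>K'\<close>, then its
  residue field is \<open>D(r)\<close>, where \<open>D\<close> is the algebraic closure of \<open>\<kappa>'\<close> in it and \<open>r\<close> is transcendental
  over \<open>D\<close>. Here it gives \<open>K = D(r)\<close> with \<open>k \<subseteq> D\<close>, so \<open>K\<close> is ruled over \<open>k\<close>, and then
  \<open>L = K(t) = D(r, t)\<close>.
\<close>

section \<open>Subrings, subfields and polynomials over them\<close>

lemma subring_0: "is_subring A \<Longrightarrow> 0 \<in> A"
  unfolding is_subring_def by (metis diff_self)

lemma subring_1: "is_subring A \<Longrightarrow> 1 \<in> A"
  unfolding is_subring_def by blast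

lemma subring_diff: "is_subring A \<Longrightarrow> x \<in> A \<Longrightarrow> y \<in> A \<Longrightarrow> x - y \<in> A"
  unfolding is_subring_def by blast

lemma subring_uminus: "is_subring A \<Longrightarrow> x \<in> A \<Longrightarrow> - x \<in> A"
  using subring_diff[of A 0 x] subring_0[of A] by simp

lemma subring_add: "is_subring A \<Longrightarrow> x \<in> A \<Longrightarrow> y \<in> A \<Longrightarrow> x + y \<in> A"
  using subring_diff[of A x "- y"] subring_uminus[of A y] by simp

lemma subring_mult: "is_subring A \<Longrightarrow> x \<in> A \<Longrightarrow> y \<in> A \<Longrightarrow> x * y \<in> A"
  unfolding is_subring_def by blast

lemma subring_power: "is_subring A \<Longrightarrow> x \<in> A \<Longrightarrow> x ^ n \<in> A"
  by (induction n) (auto simp: subring_1 subring_mult)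

lemma subring_sum: "is_subring A \<Longrightarrow> (\<And>i. i \<in> I \<Longrightarrow> f i \<in> A) \<Longrightarrow> sum f I \<in> A"
  by (induction I rule: infinite_finite_induct) (auto simp: subring_0 subring_add)

lemma subring_prod: "is_subring A \<Longrightarrow> (\<And>i. i \<in> I \<Longrightarrow> f i \<in> A) \<Longrightarrow> prod f I \<in> A"
  by (induction I rule: infinite_finite_induct) (auto simp: subring_1 subring_mult)

lemmas subring_intros =
  subring_0 subring_1 subring_diff subring_uminus subring_add subring_mult subring_power
  subring_sum subring_prod

lemma subfield_subring: "is_subfield K \<Longrightarrow> is_subring K"
  unfolding is_subfield_def by blast

lemma subfield_inverse: "is_subfield K \<Longrightarrow> x \<in> K \<Longrightarrow> inverse x \<in> K"
  unfolding is_subfield_def by blast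

lemma subfield_divide: "is_subfield K \<Longrightarrow> x \<in> K \<Longrightarrow> y \<in> K \<Longrightarrow> x / y \<in> K"
  by (simp add: divide_inverse subfield_inverse subfield_subring subring_mult)

definition polys_over :: "'a::comm_ring_1 set \<Rightarrow> 'a poly set" where
  "polys_over A = {p. \<forall>i. coeff p i \<in> A}"

lemma polys_overD: "p \<in> polys_over A \<Longrightarrow> coeff p i \<in> A"
  unfolding polys_over_def by blast

lemma polys_overI: "(\<And>i. coeff p i \<in> A) \<Longrightarrow> p \<in> polys_over A"
  unfolding polys_over_def by blast

lemma polys_over_mono: "A \<subseteq> B \<Longrightarrow> p \<in> polys_over A \<Longrightarrow> p \<in> polys_over B"
  unfolding polys_over_def by blast

lemma subring_polys_over:
  assumes A: "is_subring A" shows "is_subring (polys_over A)"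
  unfolding is_subring_def
proof (intro conjI ballI)
  show "1 \<in> polys_over A"
    using subring_0[OF A] subring_1[OF A] by (auto intro!: polys_overI simp: coeff_1)
next
  fix p q assume pq: "p \<in> polys_over A" "q \<in> polys_over A"
  show "p - q \<in> polys_over A"
    using pq by (auto intro!: polys_overI subring_diff[OF A] dest: polys_overD)
  show "p * q \<in> polys_over A"
    using pq by (auto intro!: polys_overI subring_sum[OF A] subring_mult[OF A] dest: polys_overD simp: coeff_mult)
qed

lemma pCons_polys_over: "a \<in> A \<Longrightarrow> p \<in> polys_over A \<Longrightarrow> pCons a p \<in> polys_over A"
  unfolding polys_over_def by (auto simp: coeff_pCons split: nat.split)

lemma pCons_polys_overD:
  assumes "pCons a p \<in> polys_over A" shows "a \<in> A \<and> p \<in> polys_over A"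
proof
  show "a \<in> A" using polys_overD[OF assms, of 0] by simp
  show "p \<in> polys_over A"
  proof (rule polys_overI)
    show "coeff p i \<in> A" for i using polys_overD[OF assms, of "Suc i"] by simp
  qed
qed

lemma const_polys_over: "is_subring A \<Longrightarrow> a \<in> A \<Longrightarrow> [:a:] \<in> polys_over A"
  by (intro pCons_polys_over) (auto simp: polys_over_def subring_0)

lemma monom_polys_over: "is_subring A \<Longrightarrow> a \<in> A \<Longrightarrow> monom a n \<in> polys_over A"
  unfolding polys_over_def by (auto simp: subring_0)

lemma smult_polys_over: "is_subring A \<Longrightarrow> a \<in> A \<Longrightarrow> p \<in> polys_over A \<Longrightarrow> smult a p \<in> polys_over A"
  unfolding polys_over_def by (auto simp: subring_mult)

lemma poly_mem_subring: "is_subring A \<Longrightarrow> p \<in> polys_over A \<Longrightarrow> x \<in> A \<Longrightarrow> poly p x \<in> A"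
  unfolding poly_altdef by (auto intro!: subring_intros dest: polys_overD)

lemma algebraic_over_iff: "algebraic_over A x \<longleftrightarrow> (\<exists>p\<in>polys_over A. p \<noteq> 0 \<and> poly p x = 0)"
  unfolding algebraic_over_def polys_over_def by blast

lemma algebraic_over_mono: "algebraic_over A x \<Longrightarrow> A \<subseteq> B \<Longrightarrow> algebraic_over B x"
  unfolding algebraic_over_def by blast

lemma algebraic_over_self:
  assumes "is_subring A" "x \<in> A" shows "algebraic_over A x"
  unfolding algebraic_over_iff
proof
  show "[:- x, 1:] \<in> polys_over A"
    using assms by (simp add: pCons_polys_over const_polys_over subring_1 subring_uminus)
qed simp

lemma algebraic_over_nonzero_constE:
  fixes x :: "'a::idom"
  assumes "algebraic_over A x" "x \<noteq> 0"
  obtains p where "p \<in> polys_over A" "coeff p 0 \<noteq> 0" "poly p x = 0"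
proof -
  obtain p where p: "p \<in> polys_over A" "p \<noteq> 0" "poly p x = 0"
    using assms(1) unfolding algebraic_over_iff by blast
  have "\<exists>q\<in>polys_over A. coeff q 0 \<noteq> 0 \<and> poly q x = 0"
    using p
  proof (induction p)
    case (pCons a p)
    show ?case
    proof (cases "a = 0")
      case True
      have "p \<in> polys_over A"
        using pCons.prems(1) pCons_polys_overD by blast
      then show ?thesis using pCons assms(2) True by auto
    qed (use pCons.prems in force)
  qed simp
  then show ?thesis using that by blast
qed

lemma algebraic_over_inverse:
  fixes x :: "'a::field"
  assumes "algebraic_over A x" shows "algebraic_over A (inverse x)"
proof (cases "x = 0")
  case False
  obtain p where p: "p \<in> polys_over A" "coeff p 0 \<noteq> 0" "poly p x = 0"
    using algebraic_over_nonzero_constE[OF assms False] .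
  have "0 \<in> A" using polys_overD[OF p(1), of "Suc (degree p)"] by (simp add: coeff_eq_0)
  then have "reflect_poly p \<in> polys_over A"
    using polys_overD[OF p(1)] by (intro polys_overI) (simp add: coeff_reflect_poly)
  moreover have "reflect_poly p \<noteq> 0" using p(2) by auto
  moreover have "poly (reflect_poly p) (inverse x) = 0"
    using poly_reflect_poly_nz[of "inverse x" p] False p(3) by simp
  ultimately show ?thesis unfolding algebraic_over_iff by blast
qed (use assms in simp)

section \<open>Linear dependence over a subfield\<close>

text \<open>
  The scalars form a set and not a type, so the span is generated directly; adding one multiple at a
  time makes every closure property a rule induction.
\<close>

inductive_set lin_span :: "'a::comm_ring_1 set \<Rightarrow> 'a set \<Rightarrow> 'a set"
  for E :: "'a::comm_ring_1 set" and W :: "'a set" where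
  lin_span_0: "0 \<in> lin_span E W"
| lin_span_step: "\<lbrakk>c \<in> E; w \<in> W; s \<in> lin_span E W\<rbrakk> \<Longrightarrow> c * w + s \<in> lin_span E W"

lemma lin_span_base: "c \<in> E \<Longrightarrow> w \<in> W \<Longrightarrow> c * w \<in> lin_span E W"
  using lin_span_step[OF _ _ lin_span_0, of c E w W] by simp

lemma lin_span_add: "x \<in> lin_span E W \<Longrightarrow> y \<in> lin_span E W \<Longrightarrow> x + y \<in> lin_span E W"
  by (induction rule: lin_span.induct) (auto simp: add.assoc intro: lin_span_step)

lemma lin_span_scale:
  assumes "is_subring E" "c \<in> E" "x \<in> lin_span E W" shows "c * x \<in> lin_span E W"
  using assms(3)
proof induction
  case (lin_span_step d w s)
  have "c * (d * w + s) = (c * d) * w + c * s" by (simp add: algebra_simps)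
  then show ?case
    using lin_span_step assms by (auto intro!: lin_span.lin_span_step subring_mult)
qed (simp add: lin_span_0)

lemma lin_span_sum: "(\<And>i. i \<in> I \<Longrightarrow> f i \<in> lin_span E W) \<Longrightarrow> sum f I \<in> lin_span E W"
  by (induction I rule: infinite_finite_induct) (auto simp: lin_span_0 lin_span_add)

lemma lin_span_mono: "W \<subseteq> W' \<Longrightarrow> x \<in> lin_span E W \<Longrightarrow> x \<in> lin_span E W'"
  by (rotate_tac, induction rule: lin_span.induct) (auto intro: lin_span.intros)

lemma lin_span_insertE:
  assumes "is_subring E" "x \<in> lin_span E (insert w W)"
  shows "\<exists>a\<in>E. x - a * w \<in> lin_span E W"
  using assms(2)
proof induction
  case lin_span_0
  show ?case using subring_0[OF assms(1)] by (intro bexI[of _ 0]) (auto intro: lin_span.lin_span_0)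
next
  case (lin_span_step c v s)
  then obtain a where a: "a \<in> E" "s - a * w \<in> lin_span E W" by blast
  show ?case
  proof (cases "v = w")
    case True
    then show ?thesis
      using a lin_span_step assms(1)
      by (intro bexI[of _ "c + a"]) (auto simp: algebra_simps intro: subring_add)
  next
    case False
    then have "c * v + (s - a * w) \<in> lin_span E W"
      using lin_span_step a by (intro lin_span.lin_span_step) auto
    then show ?thesis using a(1) by (intro bexI[of _ a]) (simp_all add: algebra_simps)
  qed
qed

text \<open>
  Gaussian elimination: a vector \<open>v k\<close> with nonzero coefficient at \<open>w\<close> is used to clear \<open>w\<close> from
  all the others, which leaves one vector and one generator less.
\<close>

lemma lin_span_dependent:
  fixes v :: "'i \<Rightarrow> 'a::field"
  assumes E: "is_subfield E" and "finite W" "finite I" "card W < card I"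
    and "\<And>i. i \<in> I \<Longrightarrow> v i \<in> lin_span E W"
  shows "\<exists>c. (\<forall>i\<in>I. c i \<in> E) \<and> (\<exists>i\<in>I. c i \<noteq> 0) \<and> (\<Sum>i\<in>I. c i * v i) = 0"
  using assms(2-)
proof (induction W arbitrary: I v rule: finite_induct)
  case empty
  have "v i = 0" if "i \<in> I" for i
    using empty.prems(3)[OF that] by (cases rule: lin_span.cases) auto
  then show ?case
    using empty.prems subring_1[OF subfield_subring[OF E]]
    by (intro exI[of _ "\<lambda>_. 1"]) (auto simp: card_gt_0_iff)
next
  case (insert w W)
  note R = subfield_subring[OF E]
  have "\<forall>i\<in>I. \<exists>a\<in>E. v i - a * w \<in> lin_span E W"
    using insert.prems lin_span_insertE[OF R] by blast
  then obtain a where a: "a i \<in> E" "v i - a i * w \<in> lin_span E W" if "i \<in> I" for i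
    by metis
  show ?case
  proof (cases "\<forall>i\<in>I. a i = 0")
    case True
    then have "v i \<in> lin_span E W" if "i \<in> I" for i using a[OF that] that by simp
    then show ?thesis using insert.prems insert.hyps by (intro insert.IH) auto
  next
    case False
    then obtain k where k: "k \<in> I" "a k \<noteq> 0" by blast
    define J where "J = I - {k}"
    \<comment> \<open>Subtracting this multiple of the pivot cancels the coefficient at \<open>w\<close>.\<close>
    define v' where "v' i = v i - (a i / a k) * v k" for i
    have "v' i \<in> lin_span E W" if "i \<in> J" for i
    proof -
      have i: "i \<in> I" using that J_def by auto
      have "v' i = (v i - a i * w) + (- (a i / a k)) * (v k - a k * w)"
        using k by (simp add: v'_def field_simps)
      also have "\<dots> \<in> lin_span E W"
        using a[OF i] a[OF k(1)]
        by (intro lin_span_add lin_span_scale[OF R] subring_uminus[OF R] subfield_divide[OF E])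
      finally show ?thesis .
    qed
    moreover have "finite J" "card W < card J"
      using insert.prems insert.hyps k unfolding J_def by auto
    ultimately obtain c where c: "\<forall>i\<in>J. c i \<in> E" "\<exists>i\<in>J. c i \<noteq> 0" "(\<Sum>i\<in>J. c i * v' i) = 0"
      using insert.IH[of J v'] by blast
    \<comment> \<open>The pivot takes the coefficient that turns a relation between the \<open>v' i\<close> into one between the \<open>v i\<close>.\<close>
    define ck where "ck = - (\<Sum>i\<in>J. c i * (a i / a k))"
    define d where "d = c(k := ck)"
    have ck: "ck \<in> E" unfolding ck_def
      using c(1) a(1) k J_def
      by (auto intro!: subring_uminus[OF R] subring_sum[OF R] subring_mult[OF R] subfield_divide[OF E])
    have I: "I = insert k J" "k \<notin> J" using k J_def by auto
    have dJ: "d i = c i" if "i \<in> J" for i using that I by (auto simp: d_def)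
    have "(\<Sum>i\<in>I. d i * v i) = ck * v k + (\<Sum>i\<in>J. c i * v i)"
      using I \<open>finite J\<close> dJ by (simp add: d_def)
    also have "(\<Sum>i\<in>J. c i * v i) = (\<Sum>i\<in>J. c i * v' i) + (\<Sum>i\<in>J. c i * (a i / a k)) * v k"
      unfolding sum_distrib_right sum.distrib[symmetric] v'_def by (simp add: algebra_simps)
    finally have "(\<Sum>i\<in>I. d i * v i) = 0" using c(3) by (simp add: ck_def)
    moreover have "\<forall>i\<in>I. d i \<in> E" using I ck c(1) dJ by (auto simp: d_def)
    moreover have "\<exists>i\<in>I. d i \<noteq> 0" using c(2) dJ I by auto
    ultimately show ?thesis by blast
  qed
qed

lemma algebraic_of_finite_span:
  fixes x :: "'a::field"
  assumes E: "is_subfield E" and "finite W" and pw: "\<And>n. x ^ n \<in> lin_span E W"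
  shows "algebraic_over E x"
proof -
  obtain c where c: "\<forall>i\<in>{..card W}. c i \<in> E" "\<exists>i\<in>{..card W}. c i \<noteq> 0"
      "(\<Sum>i\<in>{..card W}. c i * x ^ i) = 0"
    using lin_span_dependent[OF E assms(2), of "{..card W}" "\<lambda>i. x ^ i"] pw by auto
  define p where "p = (\<Sum>i\<in>{..card W}. monom (c i) i)"
  have "p \<in> polys_over E" unfolding p_def using c(1) subfield_subring[OF E]
    by (intro subring_sum[OF subring_polys_over]) (auto intro: monom_polys_over)
  moreover have "p \<noteq> 0"
  proof -
    obtain i where i: "i \<le> card W" "c i \<noteq> 0" using c(2) by auto
    have "coeff p i = c i" using i(1) by (simp add: p_def coeff_sum coeff_monom)
    then show ?thesis using i by auto
  qed
  moreover have "poly p x = 0" using c(3) by (simp add: p_def poly_sum poly_monom)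
  ultimately show ?thesis unfolding algebraic_over_iff by blast
qed

section \<open>Algebraic elements\<close>

definition ring_adjoin :: "'a::comm_ring_1 set \<Rightarrow> 'a \<Rightarrow> 'a set" where
  "ring_adjoin A x = {poly p x | p. p \<in> polys_over A}"

lemma ring_adjoinI: "p \<in> polys_over A \<Longrightarrow> poly p x \<in> ring_adjoin A x"
  unfolding ring_adjoin_def by blast

lemma ring_adjoinE:
  assumes "y \<in> ring_adjoin A x" obtains p where "p \<in> polys_over A" "y = poly p x"
  using assms unfolding ring_adjoin_def by blast

lemma subring_ring_adjoin:
  assumes "is_subring A" shows "is_subring (ring_adjoin A x)"
  unfolding is_subring_def
proof (intro conjI ballI)
  note P = subring_polys_over[OF assms]
  show "1 \<in> ring_adjoin A x" using ring_adjoinI[OF subring_1[OF P], of x] by simp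
  fix y z assume "y \<in> ring_adjoin A x" "z \<in> ring_adjoin A x"
  then obtain p q where "p \<in> polys_over A" "y = poly p x" "q \<in> polys_over A" "z = poly q x"
    by (auto elim!: ring_adjoinE)
  then show "y - z \<in> ring_adjoin A x" "y * z \<in> ring_adjoin A x"
    using ring_adjoinI[OF subring_diff[OF P], of p q x] ring_adjoinI[OF subring_mult[OF P], of p q x]
    by simp_all
qed

lemma ring_adjoin_base:
  assumes "is_subring A" shows "A \<subseteq> ring_adjoin A x"
proof
  fix a assume "a \<in> A"
  then have "[:a:] \<in> polys_over A" "a = poly [:a:] x" using const_polys_over[OF assms] by auto
  then show "a \<in> ring_adjoin A x" unfolding ring_adjoin_def by blast
qed

lemma ring_adjoin_gen:
  assumes "is_subring A" shows "x \<in> ring_adjoin A x"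
proof -
  have "[:0, 1:] \<in> polys_over A"
    using assms by (simp add: pCons_polys_over const_polys_over subring_1 subring_0)
  from ring_adjoinI[OF this, of x] show ?thesis by simp
qed

text \<open>
  Solving \<open>p(y) = 0\<close> for the leading power reduces every exponent below \<open>degree p\<close>.
\<close>

lemma power_in_span_of_root:
  fixes y :: "'a::field"
  assumes E: "is_subfield E" and p: "p \<in> polys_over E" "p \<noteq> 0" "poly p y = 0"
  shows "y ^ m \<in> lin_span E {y ^ i | i. i < degree p}"
proof (induction m rule: less_induct)
  case (less m)
  note R = subfield_subring[OF E]
  let ?n = "degree p"
  show ?case
  proof (cases "m < ?n")
    case True
    then have "1 * y ^ m \<in> lin_span E {y ^ i | i. i < ?n}"
      by (intro lin_span_base subring_1[OF R]) blast
    then show ?thesis by simp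
  next
    case False
    have "0 = (\<Sum>i\<le>?n. coeff p i * y ^ i)" using p(3) by (simp add: poly_altdef)
    also have "\<dots> = lead_coeff p * y ^ ?n + (\<Sum>i<?n. coeff p i * y ^ i)"
      by (simp add: lessThan_Suc_atMost[symmetric])
    finally have "lead_coeff p * y ^ ?n = - (\<Sum>i<?n. coeff p i * y ^ i)"
      by (simp add: eq_neg_iff_add_eq_0)
    then have "y ^ ?n = - (\<Sum>i<?n. coeff p i * y ^ i) / lead_coeff p"
      using p(2) by (simp add: field_simps)
    also have "\<dots> = (\<Sum>i<?n. - (coeff p i / lead_coeff p) * y ^ i)"
      by (simp add: sum_divide_distrib sum_negf)
    finally have yn: "y ^ ?n = (\<Sum>i<?n. - (coeff p i / lead_coeff p) * y ^ i)" .
    have "y ^ m = y ^ (m - ?n) * y ^ ?n" using False by (simp flip: power_add)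
    also have "\<dots> = (\<Sum>i<?n. - (coeff p i / lead_coeff p) * y ^ (m - ?n + i))"
      unfolding yn by (simp add: sum_distrib_left power_add mult_ac)
    also have "\<dots> \<in> lin_span E {y ^ i | i. i < degree p}"
      using False p(1) less.IH
      by (intro lin_span_sum lin_span_scale[OF R] subring_uminus[OF R] subfield_divide[OF E])
         (auto dest: polys_overD)
    finally show ?thesis .
  qed
qed

lemma ring_adjoin_subset_span:
  fixes y :: "'a::field"
  assumes E: "is_subfield E" and p: "p \<in> polys_over E" "p \<noteq> 0" "poly p y = 0"
  shows "ring_adjoin E y \<subseteq> lin_span E {y ^ i | i. i < degree p}"
proof
  fix x assume "x \<in> ring_adjoin E y"
  then obtain q where q: "q \<in> polys_over E" "x = poly q y" unfolding ring_adjoin_def by blast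
  show "x \<in> lin_span E {y ^ i | i. i < degree p}"
    unfolding q(2) poly_altdef using polys_overD[OF q(1)] power_in_span_of_root[OF assms]
    by (intro lin_span_sum lin_span_scale[OF subfield_subring[OF E]]) auto
qed

text \<open>
  If \<open>x\<close> is a root of a polynomial with constant term \<open>a \<noteq> 0\<close>, then \<open>a = - x * q(x)\<close>, so \<open>1/x\<close> is
  a polynomial expression in \<open>x\<close>.
\<close>

lemma subfield_of_algebraic_subring:
  fixes R :: "'a::field set"
  assumes R: "is_subring R" and "E \<subseteq> R" and alg: "\<And>x. x \<in> R \<Longrightarrow> algebraic_over E x"
    and E: "is_subfield E"
  shows "is_subfield R"
  unfolding is_subfield_def
proof (intro conjI ballI R)
  fix x assume x: "x \<in> R"
  show "inverse x \<in> R"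
  proof (cases "x = 0")
    case False
    obtain p where p: "p \<in> polys_over E" "coeff p 0 \<noteq> 0" "poly p x = 0"
      using algebraic_over_nonzero_constE[OF alg[OF x] False] .
    obtain a q where pq: "p = pCons a q" by (cases p)
    have q: "q \<in> polys_over E"
      using p(1) pCons_polys_overD pq by blast
    have a: "a \<in> E" "a \<noteq> 0" using polys_overD[OF p(1), of 0] p(2) by (auto simp: pq)
    have "a + x * poly q x = 0" using p(3) pq by simp
    then have "x * (- inverse a * poly q x) = 1"
      using a(2) by (simp add: field_simps add_eq_0_iff)
    then have "inverse x = - inverse a * poly q x" by (rule inverse_unique)
    also have "\<dots> \<in> R"
      using poly_mem_subring[OF R polys_over_mono[OF assms(2) q] x] subfield_inverse[OF E a(1)] assms(2)
      by (intro subring_mult[OF R] subring_uminus[OF R]) auto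
    finally show ?thesis .
  qed (use x in simp)
qed

lemma ring_adjoin_algebraic_subfield:
  fixes y :: "'a::field"
  assumes E: "is_subfield E" and "algebraic_over E y"
  shows "is_subfield (ring_adjoin E y)"
proof -
  note R = subfield_subring[OF E]
  obtain p where p: "p \<in> polys_over E" "p \<noteq> 0" "poly p y = 0"
    using assms(2) unfolding algebraic_over_iff by blast
  show ?thesis
  proof (rule subfield_of_algebraic_subring[OF subring_ring_adjoin[OF R] ring_adjoin_base[OF R] _ E])
    fix x assume x: "x \<in> ring_adjoin E y"
    show "algebraic_over E x"
      using subring_power[OF subring_ring_adjoin[OF R] x] ring_adjoin_subset_span[OF E p]
      by (intro algebraic_of_finite_span[OF E, of "{y ^ i | i. i < degree p}"]) auto
  qed
qed

text \<open>
  Containment in the span of a finite set, rather than equality, expresses an upper bound on the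
  dimension, which is all that the algebraicity of the elements of \<open>R\<close> rests on.
\<close>

definition finite_ext :: "'a::field set \<Rightarrow> 'a set \<Rightarrow> bool" where
  "finite_ext E R \<longleftrightarrow> is_subfield R \<and> E \<subseteq> R \<and> (\<exists>W. finite W \<and> R \<subseteq> lin_span E W)"

lemma finite_ext_algebraic:
  assumes "is_subfield E" "finite_ext E R" "x \<in> R" shows "algebraic_over E x"
proof -
  obtain W where W: "finite W" "R \<subseteq> lin_span E W" and R: "is_subring R"
    using assms(2) subfield_subring unfolding finite_ext_def by blast
  show ?thesis
    using W(2) subring_power[OF R assms(3)] by (intro algebraic_of_finite_span[OF assms(1) W(1)]) blast
qed

lemma finite_ext_refl: "is_subfield E \<Longrightarrow> finite_ext E E"
  unfolding finite_ext_def
  using lin_span_base[of _ E 1 "{1}"] by (auto intro!: exI[of _ "{1}"])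

lemma finite_ext_simple:
  assumes "is_subfield E" "algebraic_over E y" shows "finite_ext E (ring_adjoin E y)"
proof -
  obtain p where p: "p \<in> polys_over E" "p \<noteq> 0" "poly p y = 0"
    using assms(2) unfolding algebraic_over_iff by blast
  have "finite {y ^ i | i. i < degree p}" by simp
  then show ?thesis
    unfolding finite_ext_def
    using ring_adjoin_algebraic_subfield[OF assms] ring_adjoin_base[OF subfield_subring[OF assms(1)]]
      ring_adjoin_subset_span[OF assms(1) p] by blast
qed

lemma finite_ext_trans:
  assumes E: "is_subfield E" and "finite_ext E R" "finite_ext R R'" shows "finite_ext E R'"
proof -
  obtain W where W: "finite W" "R \<subseteq> lin_span E W" using assms unfolding finite_ext_def by blast
  obtain Y where Y: "finite Y" "R' \<subseteq> lin_span R Y" using assms unfolding finite_ext_def by blast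
  let ?P = "(\<lambda>(w, y). w * y) ` (W \<times> Y)"
  have prod: "c * y \<in> lin_span E ?P" if "c \<in> lin_span E W" "y \<in> Y" for c y
    using that(1)
  proof induction
    case (lin_span_step d w s)
    have "(d * w + s) * y = d * (w * y) + s * y" by (simp add: algebra_simps)
    then show ?case using lin_span_step that(2) by (auto intro!: lin_span.lin_span_step)
  qed (simp add: lin_span_0)
  have "x \<in> lin_span E ?P" if "x \<in> lin_span R Y" for x
    using that
  proof induction
    case (lin_span_step c w s)
    then show ?case using prod W(2) by (intro lin_span_add) auto
  qed (simp add: lin_span_0)
  then have "R' \<subseteq> lin_span E ?P" using Y(2) by blast
  moreover have "finite ?P" using W(1) Y(1) by blast
  ultimately show ?thesis using assms unfolding finite_ext_def by (meson order_trans)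
qed

text \<open>
  Adjoin the elements one at a time: each is still algebraic over the field reached so far. This is
  the source of both closure properties of algebraic elements below.
\<close>

lemma finite_ext_of_algebraics:
  assumes "is_subfield E" "finite F" "\<And>x. x \<in> F \<Longrightarrow> algebraic_over E x"
  shows "\<exists>R. finite_ext E R \<and> F \<subseteq> R"
  using assms(2,3)
proof (induction F rule: finite_induct)
  case empty
  show ?case using finite_ext_refl[OF assms(1)] by blast
next
  case (insert y F)
  then obtain R where R: "finite_ext E R" "F \<subseteq> R" by blast
  have sub: "is_subfield R" "E \<subseteq> R" using R(1) unfolding finite_ext_def by auto
  have "algebraic_over R y" using insert.prems sub(2) algebraic_over_mono by blast
  then have "finite_ext R (ring_adjoin R y)" using finite_ext_simple sub(1) by blast
  then show ?case
    using finite_ext_trans[OF assms(1) R(1)] R(2) ring_adjoin_base ring_adjoin_gen subfield_subring[OF sub(1)]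
    by (metis (no_types, lifting) insert_subset order_trans)
qed

definition alg_elements :: "'a::field set \<Rightarrow> 'a set" where
  "alg_elements E = {x. algebraic_over E x}"

lemma alg_elements_base: "is_subfield E \<Longrightarrow> E \<subseteq> alg_elements E"
  unfolding alg_elements_def using algebraic_over_self subfield_subring by blast

lemma alg_elements_mono: "E \<subseteq> E' \<Longrightarrow> alg_elements E \<subseteq> alg_elements E'"
  unfolding alg_elements_def using algebraic_over_mono by blast

text \<open>
  Two algebraic elements lie in one finite extension, which contains their difference and product.
\<close>

lemma subfield_alg_elements:
  assumes E: "is_subfield E" shows "is_subfield (alg_elements E)"
proof -
  have "x - y \<in> alg_elements E \<and> x * y \<in> alg_elements E"
    if "x \<in> alg_elements E" "y \<in> alg_elements E" for x y
  proof -
    obtain R where R: "finite_ext E R" "{x, y} \<subseteq> R"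
      using finite_ext_of_algebraics[OF E, of "{x, y}"] \<open>x \<in> _\<close> \<open>y \<in> _\<close>
      unfolding alg_elements_def by auto
    then have "is_subring R" unfolding finite_ext_def using subfield_subring by blast
    then have "x - y \<in> R" "x * y \<in> R" using R(2) by (auto intro: subring_intros)
    then show ?thesis unfolding alg_elements_def using finite_ext_algebraic[OF E R(1)] by blast
  qed
  moreover have "1 \<in> alg_elements E"
    using alg_elements_base[OF E] subring_1[OF subfield_subring[OF E]] by blast
  ultimately show ?thesis
    unfolding is_subfield_def is_subring_def
    by (auto simp: alg_elements_def algebraic_over_inverse)
qed

text \<open>
  The finitely many coefficients of an equation for \<open>x\<close> lie in one finite extension of \<open>E\<close>, so \<open>x\<close>
  lies in a finite extension as well.
\<close>

lemma alg_elements_idem: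
  assumes E: "is_subfield E" and x: "algebraic_over (alg_elements E) x"
  shows "x \<in> alg_elements E"
proof -
  obtain p where p: "p \<in> polys_over (alg_elements E)" "p \<noteq> 0" "poly p x = 0"
    using x unfolding algebraic_over_iff by blast
  have "coeff p ` {..degree p} \<subseteq> alg_elements E" using polys_overD[OF p(1)] by blast
  then obtain R where R: "finite_ext E R" "coeff p ` {..degree p} \<subseteq> R"
    using finite_ext_of_algebraics[OF E, of "coeff p ` {..degree p}"]
    unfolding alg_elements_def by blast
  have sub: "is_subfield R" using R(1) unfolding finite_ext_def by auto
  have "coeff p i \<in> R" for i
    using R(2) subring_0[OF subfield_subring[OF sub]] by (cases "i \<le> degree p") (auto simp: coeff_eq_0)
  then have "algebraic_over R x" unfolding algebraic_over_def using p by blast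
  then have "finite_ext E (ring_adjoin R x)"
    using finite_ext_trans[OF E R(1) finite_ext_simple[OF sub]] by blast
  then show ?thesis
    unfolding alg_elements_def
    using finite_ext_algebraic[OF E] ring_adjoin_gen[OF subfield_subring[OF sub]] by blast
qed

section \<open>Fields of quotients and simple extensions\<close>

definition quotients :: "'a::field set \<Rightarrow> 'a set" where
  "quotients R = {a / b | a b. a \<in> R \<and> b \<in> R \<and> b \<noteq> 0}"

lemma quotientsI: "a \<in> R \<Longrightarrow> b \<in> R \<Longrightarrow> b \<noteq> 0 \<Longrightarrow> a / b \<in> quotients R"
  unfolding quotients_def by blast

lemma quotientsE:
  assumes "x \<in> quotients R" obtains a b where "a \<in> R" "b \<in> R" "b \<noteq> 0" "x = a / b"
  using assms unfolding quotients_def by blast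

lemma quotients_base: "is_subring R \<Longrightarrow> R \<subseteq> quotients R"
  using quotientsI[of _ R 1] subring_1 by force

lemma subfield_quotients:
  assumes R: "is_subring R" shows "is_subfield (quotients R)"
  unfolding is_subfield_def is_subring_def
proof (intro conjI ballI)
  show "1 \<in> quotients R" using quotients_base[OF R] subring_1[OF R] by blast
next
  fix x y assume "x \<in> quotients R" "y \<in> quotients R"
  then obtain a b c d where
    ab: "a \<in> R" "b \<in> R" "b \<noteq> 0" "x = a / b" and cd: "c \<in> R" "d \<in> R" "d \<noteq> 0" "y = c / d"
    by (metis quotientsE)
  have "(a * d - c * b) / (b * d) \<in> quotients R"
    using ab cd by (intro quotientsI subring_diff[OF R] subring_mult[OF R]) auto
  then show "x - y \<in> quotients R" using ab cd by (simp add: diff_frac_eq mult.commute)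
  have "(a * c) / (b * d) \<in> quotients R"
    using ab cd by (intro quotientsI subring_mult[OF R]) auto
  then show "x * y \<in> quotients R" using ab cd by simp
next
  fix x assume x: "x \<in> quotients R"
  then obtain a b where ab: "a \<in> R" "b \<in> R" "b \<noteq> 0" "x = a / b" by (rule quotientsE)
  show "inverse x \<in> quotients R"
    using ab x quotientsI[of b R a] by (cases "a = 0") auto
qed

lemma quotients_minimal: "is_subfield L \<Longrightarrow> R \<subseteq> L \<Longrightarrow> quotients R \<subseteq> L"
  by (auto elim!: quotientsE intro!: subfield_divide)

lemma clear_denominators:
  assumes R: "is_subring R" and p: "p \<in> polys_over (quotients R)"
  shows "\<exists>d\<in>R. d \<noteq> 0 \<and> smult d p \<in> polys_over R"
  using p
proof (induction p)
  case 0
  show ?case using subring_1[OF R] subring_0[OF R] by (auto simp: polys_over_def intro!: bexI[of _ 1])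
next
  case (pCons c p)
  have "p \<in> polys_over (quotients R)"
    using pCons.prems pCons_polys_overD by blast
  then obtain d where d: "d \<in> R" "d \<noteq> 0" "smult d p \<in> polys_over R" using pCons.IH by blast
  have "c \<in> quotients R" using polys_overD[OF pCons.prems, of 0] by simp
  then obtain a b where ab: "a \<in> R" "b \<in> R" "b \<noteq> 0" "c = a / b" by (rule quotientsE)
  have "smult (d * b) (pCons c p) = pCons (d * a) (smult b (smult d p))"
    using ab by (simp add: mult_ac)
  also have "\<dots> \<in> polys_over R"
    using ab d by (blast intro: pCons_polys_over smult_polys_over[OF R] subring_mult[OF R])
  finally show ?case using d ab by (intro bexI[of _ "d * b"] conjI subring_mult[OF R]) auto
qed

lemma algebraic_over_quotients:
  assumes R: "is_subring R" and "algebraic_over (quotients R) x"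
  shows "algebraic_over R x"
proof -
  obtain p where p: "p \<in> polys_over (quotients R)" "p \<noteq> 0" "poly p x = 0"
    using assms(2) unfolding algebraic_over_iff by blast
  obtain d where "d \<in> R" "d \<noteq> 0" "smult d p \<in> polys_over R"
    using clear_denominators[OF R p(1)] by blast
  then show ?thesis unfolding algebraic_over_iff using p by (intro bexI[of _ "smult d p"]) auto
qed

lemma subfield_field_adjoin: "is_subfield (field_adjoin K X)"
  unfolding field_adjoin_def
  by (rule hull_in) (auto simp: is_subfield_def is_subring_def)

lemma field_adjoin_superset: "K \<union> X \<subseteq> field_adjoin K X"
  unfolding field_adjoin_def by (rule hull_subset)

lemma field_adjoin_minimal: "is_subfield L \<Longrightarrow> K \<subseteq> L \<Longrightarrow> X \<subseteq> L \<Longrightarrow> field_adjoin K X \<subseteq> L"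
  unfolding field_adjoin_def by (rule hull_minimal) auto

lemma field_adjoin_mono: "X \<subseteq> Y \<Longrightarrow> field_adjoin K X \<subseteq> field_adjoin K Y"
  using field_adjoin_superset[of K Y] by (intro field_adjoin_minimal subfield_field_adjoin) auto

lemma field_adjoin_insert: "field_adjoin K (insert x X) = field_adjoin (field_adjoin K X) {x}"
proof
  show "field_adjoin K (insert x X) \<subseteq> field_adjoin (field_adjoin K X) {x}"
    using field_adjoin_superset[of K X] field_adjoin_superset[of "field_adjoin K X" "{x}"]
    by (intro field_adjoin_minimal subfield_field_adjoin) auto
  show "field_adjoin (field_adjoin K X) {x} \<subseteq> field_adjoin K (insert x X)"
    using field_adjoin_superset[of K "insert x X"]
    by (intro field_adjoin_minimal subfield_field_adjoin) auto
qed

lemma field_adjoin_single: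
  assumes "is_subfield E" shows "field_adjoin E {x} = quotients (ring_adjoin E x)"
proof
  note R = subring_ring_adjoin[OF subfield_subring[OF assms]]
  show "field_adjoin E {x} \<subseteq> quotients (ring_adjoin E x)"
    using quotients_base[OF R] ring_adjoin_base[OF subfield_subring[OF assms]]
      ring_adjoin_gen[OF subfield_subring[OF assms]]
    by (intro field_adjoin_minimal subfield_quotients R) blast+
  have "ring_adjoin E x \<subseteq> field_adjoin E {x}"
    using field_adjoin_superset[of E "{x}"]
    by (auto elim!: ring_adjoinE
        intro!: poly_mem_subring[OF subfield_subring[OF subfield_field_adjoin]] intro: polys_over_mono)
  then show "quotients (ring_adjoin E x) \<subseteq> field_adjoin E {x}"
    by (rule quotients_minimal[OF subfield_field_adjoin])
qed

lemma field_adjoin_singleE: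
  assumes "is_subfield E" "y \<in> field_adjoin E {x}"
  obtains p q where "p \<in> polys_over E" "q \<in> polys_over E" "poly q x \<noteq> 0" "y = poly p x / poly q x"
  using assms(2) unfolding field_adjoin_single[OF assms(1)]
  by (metis quotientsE ring_adjoinE)

section \<open>The exchange property and transcendence degree\<close>

text \<open>
  Clearing denominators, \<open>y\<close> satisfies a polynomial relation \<open>P(x, y) = 0\<close> over \<open>E\<close>. Read as a
  polynomial in \<open>x\<close>, its coefficients are polynomials in \<open>y\<close> over \<open>E\<close>, and a nonzero one does not
  vanish at \<open>y\<close> because \<open>y\<close> is transcendental over \<open>E\<close>.
\<close>

lemma algebraic_exchange:
  assumes E: "is_subfield E" and y: "algebraic_over (field_adjoin E {x}) y" "\<not> algebraic_over E y"
  shows "algebraic_over (field_adjoin E {y}) x"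
proof -
  note R = subfield_subring[OF E]
  have "algebraic_over (ring_adjoin E x) y"
    using algebraic_over_quotients[OF subring_ring_adjoin[OF R]] y(1) field_adjoin_single[OF E] by simp
  then obtain p where p: "p \<in> polys_over (ring_adjoin E x)" "p \<noteq> 0" "poly p y = 0"
    unfolding algebraic_over_iff by blast
  have "\<exists>c\<in>polys_over E. coeff p i = poly c x" for i
    using polys_overD[OF p(1), of i] unfolding ring_adjoin_def by blast
  then obtain c where c: "c i \<in> polys_over E" "coeff p i = poly (c i) x" for i by metis
  define d where "d = degree p"
  define N where "N = Max ((degree \<circ> c) ` {..d})"
  have N: "degree (c i) \<le> N" if "i \<le> d" for i
    unfolding N_def using that by (intro Max_ge) auto
  \<comment> \<open>\<open>P = \<Sum> coeff (c i) j * x^j * y^i\<close>, so \<open>q j\<close> collects the coefficient of \<open>x^j\<close>.\<close>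
  define q where "q j = (\<Sum>i\<le>d. monom (coeff (c i) j) i)" for j
  have q: "q j \<in> polys_over E" for j
    unfolding q_def using polys_overD[OF c(1)]
    by (intro subring_sum[OF subring_polys_over[OF R]] monom_polys_over[OF R])
  define Q where "Q = (\<Sum>j\<le>N. monom (poly (q j) y) j)"
  have "poly Q x = (\<Sum>j\<le>N. \<Sum>i\<le>d. coeff (c i) j * y ^ i * x ^ j)"
    by (simp add: Q_def q_def poly_sum poly_monom sum_distrib_right)
  also have "\<dots> = (\<Sum>i\<le>d. (\<Sum>j\<le>N. coeff (c i) j * x ^ j) * y ^ i)"
    by (subst sum.swap) (simp add: sum_distrib_right sum_distrib_left mult_ac)
  also have "\<dots> = (\<Sum>i\<le>d. coeff p i * y ^ i)"
  proof (intro sum.cong refl)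
    fix i assume "i \<in> {..d}"
    then have "poly (c i) x = (\<Sum>j\<le>N. coeff (c i) j * x ^ j)"
      unfolding poly_altdef using N[of i] by (intro sum.mono_neutral_left) (auto simp: coeff_eq_0)
    then show "(\<Sum>j\<le>N. coeff (c i) j * x ^ j) * y ^ i = coeff p i * y ^ i" using c(2) by simp
  qed
  also have "\<dots> = 0" using p(3) by (simp add: poly_altdef d_def)
  finally have root: "poly Q x = 0" .
  have "c d \<noteq> 0" using c(2)[of d] p(2) unfolding d_def by auto
  then obtain j where j: "coeff (c d) j \<noteq> 0" by (metis leading_coeff_neq_0)
  then have "j \<le> N" using N[of d] le_degree by (metis le_refl order_trans)
  have "coeff (q j) d \<noteq> 0" using j by (simp add: q_def coeff_sum coeff_monom)
  then have "poly (q j) y \<noteq> 0" using y(2) q[of j] unfolding algebraic_over_iff by fastforce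
  moreover have "coeff Q j = poly (q j) y" using \<open>j \<le> N\<close> by (simp add: Q_def coeff_sum coeff_monom)
  ultimately have "Q \<noteq> 0" by auto
  moreover have "Q \<in> polys_over (field_adjoin E {y})"
  proof -
    have sub: "is_subring (field_adjoin E {y})" by (rule subfield_subring[OF subfield_field_adjoin])
    have "poly (q j) y \<in> field_adjoin E {y}" for j
      using field_adjoin_superset[of E "{y}"]
      by (intro poly_mem_subring[OF sub] polys_over_mono[OF _ q]) auto
    then show ?thesis
      unfolding Q_def by (intro subring_sum[OF subring_polys_over[OF sub]] monom_polys_over[OF sub])
  qed
  ultimately show ?thesis using root unfolding algebraic_over_iff by blast
qed

text \<open>
  The closure operator of the matroid of algebraic dependence over \<open>k\<close>.
\<close>

definition alg_span :: "'a::field set \<Rightarrow> 'a set \<Rightarrow> 'a set" where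
  "alg_span k S = alg_elements (field_adjoin k S)"

lemma subfield_alg_span: "is_subfield (alg_span k S)"
  unfolding alg_span_def by (intro subfield_alg_elements subfield_field_adjoin)

lemma alg_span_superset: "k \<union> S \<subseteq> alg_span k S"
  unfolding alg_span_def
  using field_adjoin_superset alg_elements_base[OF subfield_field_adjoin] by (rule order_trans)

lemma alg_span_mono: "S \<subseteq> T \<Longrightarrow> alg_span k S \<subseteq> alg_span k T"
  unfolding alg_span_def by (intro alg_elements_mono field_adjoin_mono)

lemma alg_span_closed: "algebraic_over (alg_span k S) x \<Longrightarrow> x \<in> alg_span k S"
  unfolding alg_span_def by (intro alg_elements_idem subfield_field_adjoin)

lemma alg_span_minimal:
  assumes "T \<subseteq> alg_span k S" shows "alg_span k T \<subseteq> alg_span k S"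
proof
  fix x assume "x \<in> alg_span k T"
  then have "algebraic_over (field_adjoin k T) x" unfolding alg_span_def alg_elements_def by blast
  moreover have "field_adjoin k T \<subseteq> alg_span k S"
    using alg_span_superset[of k S] assms by (intro field_adjoin_minimal subfield_alg_span) auto
  ultimately show "x \<in> alg_span k S" using algebraic_over_mono alg_span_closed by blast
qed

lemma alg_span_exchange:
  assumes "y \<in> alg_span k (insert x S)" "y \<notin> alg_span k S"
  shows "x \<in> alg_span k (insert y S)"
  using assms algebraic_exchange[OF subfield_field_adjoin, of k S x y]
  by (simp add: alg_span_def alg_elements_def
      field_adjoin_insert[of k x S] field_adjoin_insert[of k y S])

text \<open>
  Algebraic independence in the sequential form in which it is both built up and used: every entry is
  transcendental over \<open>k\<close> with the entries after it adjoined.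
\<close>

primrec alg_indep_list :: "'a::field set \<Rightarrow> 'a list \<Rightarrow> bool" where
  "alg_indep_list k [] \<longleftrightarrow> True"
| "alg_indep_list k (y # ys) \<longleftrightarrow> y \<notin> alg_span k (set ys) \<and> alg_indep_list k ys"

text \<open>
  The exchange lemma of Steinitz: the entries of \<open>ys\<close> replace as many elements of the spanning set
  \<open>S\<close>, so transcendence degree is well defined.
\<close>

lemma steinitz:
  assumes "alg_indep_list k ys" "finite S" "alg_span k S = UNIV"
  shows "\<exists>T\<subseteq>S. alg_span k (set ys \<union> T) = UNIV \<and> card T + length ys \<le> card S"
  using assms(1)
proof (induction ys)
  case Nil
  then show ?case using assms by auto
next
  case (Cons y ys)
  then obtain T where T: "T \<subseteq> S" "alg_span k (set ys \<union> T) = UNIV" "card T + length ys \<le> card S"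
    by auto
  have finT: "finite T" using T(1) assms(2) finite_subset by blast
  \<comment> \<open>Adding the elements of \<open>T\<close> one at a time, \<open>s\<close> is the first that brings \<open>y\<close> into the span.\<close>
  have "\<exists>s U. s \<in> T \<and> U \<subseteq> T \<and> y \<notin> alg_span k (set ys \<union> U) \<and> y \<in> alg_span k (insert s (set ys \<union> U))"
  proof -
    have "U \<subseteq> T \<Longrightarrow> y \<in> alg_span k (set ys \<union> U) \<Longrightarrow> ?thesis" if "finite U" for U
      using that
    proof (induction U rule: finite_induct)
      case empty
      then show ?case using Cons.prems by simp
    next
      case (insert s U)
      then show ?case by (cases "y \<in> alg_span k (set ys \<union> U)") auto
    qed
    then show ?thesis using finT T(2) by blast
  qed
  then obtain s U where s: "s \<in> T" "U \<subseteq> T" "y \<notin> alg_span k (set ys \<union> U)"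
      "y \<in> alg_span k (insert s (set ys \<union> U))" by blast
  have "s \<notin> U" using s(3,4) by (auto simp: insert_absorb)
  have "s \<in> alg_span k (insert y (set ys \<union> U))" using alg_span_exchange[OF s(4,3)] .
  also have "\<dots> \<subseteq> alg_span k (set (y # ys) \<union> (T - {s}))"
    using s(2) \<open>s \<notin> U\<close> by (intro alg_span_mono) auto
  finally have "set ys \<union> T \<subseteq> alg_span k (set (y # ys) \<union> (T - {s}))"
    using alg_span_superset[of k "set (y # ys) \<union> (T - {s})"] by auto
  then have "alg_span k (set (y # ys) \<union> (T - {s})) = UNIV"
    using alg_span_minimal T(2) by blast
  moreover have "card (T - {s}) + length (y # ys) \<le> card S"
    using T(3) s(1) finT card_Suc_Diff1[OF finT s(1)] by simp
  ultimately show ?case using T(1) by (intro exI[of _ "T - {s}"]) auto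
qed

corollary alg_indep_length_le:
  assumes "alg_indep_list k ys" "finite S" "alg_span k S = UNIV"
  shows "length ys \<le> card S"
  using steinitz[OF assms] by auto

section \<open>Purely transcendental extensions\<close>

abbreviation mono_at :: "('a \<Rightarrow>\<^sub>0 nat) \<Rightarrow> 'a::comm_ring_1" where
  "mono_at m \<equiv> (\<Prod>x\<in>Poly_Mapping.keys m. x ^ Poly_Mapping.lookup m x)"

lemma eval_mpoly_superset:
  assumes "finite I" "Poly_Mapping.keys p \<subseteq> I"
  shows "eval_mpoly p = (\<Sum>m\<in>I. Poly_Mapping.lookup p m * mono_at m)"
  unfolding eval_mpoly_def using assms
  by (intro sum.mono_neutral_left) (auto simp: in_keys_iff)

lemma mono_at_split:
  "mono_at m = t ^ Poly_Mapping.lookup m t * mono_at (Poly_Mapping.update t 0 m)"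
proof -
  let ?r = "Poly_Mapping.update t 0 m"
  have keys: "Poly_Mapping.keys ?r = Poly_Mapping.keys m - {t}" by (simp add: keys_update)
  have "mono_at ?r = (\<Prod>x\<in>Poly_Mapping.keys m - {t}. x ^ Poly_Mapping.lookup m x)"
    unfolding keys by (intro prod.cong refl) (auto simp: lookup_update)
  then show ?thesis
    by (cases "t \<in> Poly_Mapping.keys m") (simp_all add: prod.remove in_keys_iff)
qed

lemma eval_mpoly_in_subring:
  assumes "is_subring R" "\<And>m. Poly_Mapping.lookup p m \<in> R"
    "\<And>m. m \<in> Poly_Mapping.keys p \<Longrightarrow> Poly_Mapping.keys m \<subseteq> R"
  shows "eval_mpoly p \<in> R"
  unfolding eval_mpoly_def using assms
  by (intro subring_sum[OF assms(1)] subring_mult[OF assms(1)] subring_prod[OF assms(1)]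
      subring_power[OF assms(1)]) auto

lemma alg_independent_empty: "alg_independent K {}"
  unfolding alg_independent_def
proof (intro allI impI)
  fix p :: "('a \<Rightarrow>\<^sub>0 nat) \<Rightarrow>\<^sub>0 'a"
  assume p: "(\<forall>m. Poly_Mapping.lookup p m \<in> K) \<and>
    (\<forall>m\<in>Poly_Mapping.keys p. Poly_Mapping.keys m \<subseteq> {}) \<and> eval_mpoly p = 0"
  then have "\<forall>m\<in>Poly_Mapping.keys p. m = 0" by (meson keys_eq_empty subset_empty)
  then have "Poly_Mapping.keys p \<subseteq> {0}" by blast
  then have "Poly_Mapping.lookup p 0 = 0"
    using eval_mpoly_superset[of "{0}" p] p by simp
  with \<open>Poly_Mapping.keys p \<subseteq> {0}\<close> have "Poly_Mapping.keys p = {}"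
    using in_keys_iff by fastforce
  then show "p = 0" by simp
qed

text \<open>
  A polynomial relation in \<open>insert t X\<close> is sorted by powers of \<open>t\<close>. The result is a univariate
  relation for \<open>t\<close> over \<open>K(X)\<close>; its coefficients vanish because \<open>t\<close> is transcendental, and these are
  polynomial relations in \<open>X\<close>.
\<close>

lemma alg_independent_insert:
  fixes K :: "'a::field set"
  assumes K: "is_subfield K" and X: "alg_independent K X" and t: "\<not> algebraic_over (field_adjoin K X) t"
  shows "alg_independent K (insert t X)"
  unfolding alg_independent_def
proof (intro allI impI, elim conjE)
  fix p :: "('a \<Rightarrow>\<^sub>0 nat) \<Rightarrow>\<^sub>0 'a"
  assume coeffs: "\<forall>m. Poly_Mapping.lookup p m \<in> K"
    and vars: "\<forall>m\<in>Poly_Mapping.keys p. Poly_Mapping.keys m \<subseteq> insert t X"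
    and zero: "eval_mpoly p = 0"
  define M where "M = Poly_Mapping.keys p"
  \<comment> \<open>A monomial \<open>m\<close> is \<open>t ^ e m\<close> times the monomial \<open>r m\<close> without \<open>t\<close>; \<open>P n\<close> is the coefficient
      of \<open>t ^ n\<close> as a polynomial in \<open>X\<close>.\<close>
  define e where "e m = Poly_Mapping.lookup m t" for m :: "'a \<Rightarrow>\<^sub>0 nat"
  define r where "r m = Poly_Mapping.update t 0 m" for m :: "'a \<Rightarrow>\<^sub>0 nat"
  define Mn where "Mn n = {m \<in> M. e m = n}" for n
  define P where "P n = (\<Sum>m\<in>Mn n. Poly_Mapping.single (r m) (Poly_Mapping.lookup p m))" for n
  have finM: "finite M" "finite (Mn n)" for n by (auto simp: M_def Mn_def)
  have r_inj: "m = m'" if "e m = e m'" "r m = r m'" for m m'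
  proof (rule poly_mapping_eqI)
    fix x
    have "Poly_Mapping.lookup (r m) x = Poly_Mapping.lookup (r m') x" using that by simp
    then show "Poly_Mapping.lookup m x = Poly_Mapping.lookup m' x"
      using that(1) by (cases "x = t") (auto simp: r_def e_def lookup_update)
  qed
  have P_lookup: "Poly_Mapping.lookup (P n) m' =
      (\<Sum>m\<in>Mn n. if r m = m' then Poly_Mapping.lookup p m else 0)" for n m'
    unfolding P_def by (simp add: lookup_sum lookup_single when_def)
  have P_r: "Poly_Mapping.lookup (P n) (r m) = Poly_Mapping.lookup p m" if "m \<in> Mn n" for n m
  proof -
    have "(if r m' = r m then Poly_Mapping.lookup p m' else 0) =
          (if m' = m then Poly_Mapping.lookup p m' else 0)" if "m' \<in> Mn n" for m'
      using r_inj[of m' m] that \<open>m \<in> Mn n\<close> by (auto simp: Mn_def)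
    then have "Poly_Mapping.lookup (P n) (r m) =
        (\<Sum>m'\<in>Mn n. if m' = m then Poly_Mapping.lookup p m' else 0)"
      unfolding P_lookup by (intro sum.cong refl)
    then show ?thesis using finM that by simp
  qed
  have P_keys: "Poly_Mapping.keys (P n) \<subseteq> r ` Mn n" for n
  proof
    fix m' assume "m' \<in> Poly_Mapping.keys (P n)"
    then have "(\<Sum>m\<in>Mn n. if r m = m' then Poly_Mapping.lookup p m else 0) \<noteq> 0"
      by (simp add: in_keys_iff P_lookup)
    then obtain m where "m \<in> Mn n" "(if r m = m' then Poly_Mapping.lookup p m else 0) \<noteq> 0"
      by (rule sum.not_neutral_contains_not_neutral)
    then show "m' \<in> r ` Mn n" by (auto split: if_splits)
  qed
  have P_coeffs: "\<forall>m. Poly_Mapping.lookup (P n) m \<in> K" for n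
    unfolding P_lookup using coeffs subring_0[OF subfield_subring[OF K]]
    by (auto intro!: subring_sum[OF subfield_subring[OF K]])
  have P_vars: "\<forall>m\<in>Poly_Mapping.keys (P n). Poly_Mapping.keys m \<subseteq> X" for n
  proof
    fix m' assume "m' \<in> Poly_Mapping.keys (P n)"
    then obtain m where m: "m \<in> M" "m' = r m" using P_keys by (auto simp: Mn_def)
    have "Poly_Mapping.keys m \<subseteq> insert t X" using vars m(1) M_def by blast
    then show "Poly_Mapping.keys m' \<subseteq> X"
      unfolding m(2) r_def by (auto simp: keys_update)
  qed
  have P_eval: "eval_mpoly (P n) = (\<Sum>m\<in>Mn n. Poly_Mapping.lookup p m * mono_at (r m))" for n
  proof -
    have "eval_mpoly (P n) = (\<Sum>m'\<in>r ` Mn n. Poly_Mapping.lookup (P n) m' * mono_at m')"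
      using finM P_keys by (intro eval_mpoly_superset) auto
    also have "\<dots> = (\<Sum>m\<in>Mn n. Poly_Mapping.lookup (P n) (r m) * mono_at (r m))"
      using r_inj by (intro sum.reindex_cong[OF _ refl refl]) (auto intro!: inj_onI simp: Mn_def)
    finally show ?thesis using P_r by simp
  qed
  define G where "G = (\<Sum>n\<in>e ` M. monom (eval_mpoly (P n)) n)"
  have "eval_mpoly p = (\<Sum>m\<in>M. Poly_Mapping.lookup p m * (t ^ e m * mono_at (r m)))"
    unfolding eval_mpoly_def M_def e_def r_def by (intro sum.cong refl) (simp flip: mono_at_split)
  also have "\<dots> = (\<Sum>n\<in>e ` M. \<Sum>m\<in>Mn n. Poly_Mapping.lookup p m * (t ^ e m * mono_at (r m)))"
    unfolding Mn_def by (rule sum.group[symmetric]) (use finM in auto)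
  also have "\<dots> = (\<Sum>n\<in>e ` M. eval_mpoly (P n) * t ^ n)"
    unfolding P_eval sum_distrib_right by (intro sum.cong refl) (auto simp: Mn_def mult_ac)
  also have "\<dots> = poly G t" by (simp add: G_def poly_sum poly_monom)
  finally have root: "poly G t = 0" using zero by simp
  have sub: "is_subring (field_adjoin K X)" by (rule subfield_subring[OF subfield_field_adjoin])
  have "eval_mpoly (P n) \<in> field_adjoin K X" for n
    using P_coeffs P_vars field_adjoin_superset[of K X]
    by (intro eval_mpoly_in_subring[OF sub]) blast+
  then have "G \<in> polys_over (field_adjoin K X)"
    unfolding G_def by (intro subring_sum[OF subring_polys_over[OF sub]] monom_polys_over[OF sub])
  then have "G = 0" using t root unfolding algebraic_over_iff by blast
  have "p = 0"
  proof (rule ccontr)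
    assume "p \<noteq> 0"
    then obtain m where m: "m \<in> M" using M_def by fastforce
    then have "coeff G (e m) = eval_mpoly (P (e m))"
      using finM by (simp add: G_def coeff_sum coeff_monom)
    then have "P (e m) = 0"
      using X P_coeffs P_vars \<open>G = 0\<close> unfolding alg_independent_def by simp
    then have "Poly_Mapping.lookup p m = 0" using P_r[of m "e m"] m by (simp add: Mn_def)
    then show False using m by (simp add: M_def in_keys_iff)
  qed
  then show "p = 0" .
qed

lemma purely_transcendental_1:
  assumes F: "is_subfield F" and x: "\<not> algebraic_over F x"
  shows "purely_transcendental F 1 (field_adjoin F {x})"
proof -
  have "field_adjoin F {} = F"
    using field_adjoin_superset[of F "{}"] field_adjoin_minimal[OF F, of F "{}"] by auto
  then have "alg_independent F {x}" using alg_independent_insert[OF F alg_independent_empty] x by simp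
  then show ?thesis unfolding purely_transcendental_def by (intro exI[of _ "{x}"]) simp
qed

lemma purely_transcendental_Suc:
  assumes F: "is_subfield F" and K: "purely_transcendental F n K" and t: "\<not> algebraic_over K t"
  shows "purely_transcendental F (Suc n) (field_adjoin K {t})"
proof -
  obtain X where X: "finite X" "card X = n" "alg_independent F X" "K = field_adjoin F X"
    using K unfolding purely_transcendental_def by blast
  have "t \<notin> K" using t algebraic_over_self subfield_subring[OF subfield_field_adjoin] X(4) by metis
  then have "t \<notin> X" using field_adjoin_superset X(4) by blast
  then show ?thesis
    unfolding purely_transcendental_def
    using X t \<open>t \<notin> X\<close> alg_independent_insert[OF F X(3), of t]
    by (intro exI[of _ "insert t X"]) (simp add: field_adjoin_insert[of F t X])
qed

section \<open>Places and the ruled residue theorem\<close>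

text \<open>
  A place of \<open>'a\<close> with values in \<open>'c\<close>: \<open>V\<close> is its valuation ring and \<open>\<rho>\<close> the residue map. The values
  of \<open>\<rho>\<close> outside \<open>V\<close> are arbitrary. The assumption \<open>pole\<close> says that \<open>V\<close> is a valuation ring
  and also that the kernel of \<open>\<rho>\<close> is its whole maximal ideal, see \<open>unit_inverse\<close>.
\<close>

locale field_place =
  fixes V :: "'a::field set" and \<rho> :: "'a \<Rightarrow> 'c::field"
  assumes subring_V: "is_subring V"
    and res_1: "\<rho> 1 = 1"
    and res_add: "\<And>x y. x \<in> V \<Longrightarrow> y \<in> V \<Longrightarrow> \<rho> (x + y) = \<rho> x + \<rho> y"
    and res_mult: "\<And>x y. x \<in> V \<Longrightarrow> y \<in> V \<Longrightarrow> \<rho> (x * y) = \<rho> x * \<rho> y"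
    and pole: "\<And>x. x \<notin> V \<Longrightarrow> inverse x \<in> V \<and> \<rho> (inverse x) = 0"
begin

lemma res_0: "\<rho> 0 = 0"
  using res_add[of 0 0] subring_0[OF subring_V] by (metis add.right_neutral add_cancel_left_right)

lemma res_diff: "x \<in> V \<Longrightarrow> y \<in> V \<Longrightarrow> \<rho> (x - y) = \<rho> x - \<rho> y"
  using res_add[of "x - y" y] subring_diff[OF subring_V, of x y] by simp

lemma unit_inverse: "x \<in> V \<Longrightarrow> \<rho> x \<noteq> 0 \<Longrightarrow> inverse x \<in> V"
  using pole[of "inverse x"] by auto

lemma res_inverse:
  assumes "x \<in> V" "\<rho> x \<noteq> 0" shows "\<rho> (inverse x) = inverse (\<rho> x)"
proof -
  have "x \<noteq> 0" using assms res_0 by auto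
  then have "\<rho> x * \<rho> (inverse x) = 1"
    using res_mult[OF assms(1) unit_inverse[OF assms]] res_1 by simp
  then show ?thesis by (rule inverse_unique[symmetric])
qed

lemma poly_res:
  assumes "p \<in> polys_over V" "x \<in> V"
  shows "poly p x \<in> V" "\<rho> (poly p x) = poly (map_poly \<rho> p) (\<rho> x)"
proof -
  show "poly p x \<in> V" using poly_mem_subring[OF subring_V assms] .
  show "\<rho> (poly p x) = poly (map_poly \<rho> p) (\<rho> x)"
    using assms(1)
  proof (induction p)
    case (pCons a p)
    have p: "p \<in> polys_over V"
      using pCons.prems pCons_polys_overD by blast
    have a: "a \<in> V" using polys_overD[OF pCons.prems, of 0] by simp
    have px: "poly p x \<in> V" using poly_mem_subring[OF subring_V p assms(2)] .
    have "\<rho> (poly (pCons a p) x) = \<rho> a + \<rho> x * \<rho> (poly p x)"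
      using a px assms(2) by (simp add: res_add res_mult subring_mult[OF subring_V])
    then show ?case using pCons.IH[OF p] pCons.hyps by (simp add: map_poly_pCons res_0)
  qed (simp add: res_0)
qed

definition residues :: "'a set \<Rightarrow> 'c set" where
  "residues K = \<rho> ` (K \<inter> V)"

lemma subfield_residues:
  assumes K: "is_subfield K" shows "is_subfield (residues K)"
  unfolding is_subfield_def is_subring_def
proof (intro conjI ballI)
  note R = subfield_subring[OF K]
  show "1 \<in> residues K"
    unfolding residues_def using res_1 subring_1[OF R] subring_1[OF subring_V]
    by (intro image_eqI[of _ _ 1]) auto
  fix x y assume "x \<in> residues K" "y \<in> residues K"
  then obtain a b where ab: "a \<in> K" "a \<in> V" "x = \<rho> a" "b \<in> K" "b \<in> V" "y = \<rho> b"
    unfolding residues_def by blast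
  show "x - y \<in> residues K"
    unfolding residues_def using ab res_diff subring_diff[OF R] subring_diff[OF subring_V]
    by (intro image_eqI[of _ _ "a - b"]) auto
  show "x * y \<in> residues K"
    unfolding residues_def using ab res_mult subring_mult[OF R] subring_mult[OF subring_V]
    by (intro image_eqI[of _ _ "a * b"]) auto
next
  note R = subfield_subring[OF K]
  fix x assume "x \<in> residues K"
  then obtain a where a: "a \<in> K" "a \<in> V" "x = \<rho> a" unfolding residues_def by blast
  show "inverse x \<in> residues K"
  proof (cases "x = 0")
    case False
    then show ?thesis
      unfolding residues_def using a res_inverse unit_inverse subfield_inverse[OF K]
      by (intro image_eqI[of _ _ "inverse a"]) auto
  qed (use \<open>x \<in> residues K\<close> in simp)
qed

lemma res_nonzero_on_subfield:
  assumes "is_subfield E" "E \<subseteq> V" "a \<in> E" "a \<noteq> 0" shows "\<rho> a \<noteq> 0"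
proof
  assume "\<rho> a = 0"
  have "inverse a \<in> V" using assms subfield_inverse by blast
  then have "\<rho> a * \<rho> (inverse a) = 1"
    using res_mult[of a "inverse a"] assms res_1 by auto
  then show False using \<open>\<rho> a = 0\<close> by simp
qed

text \<open>
  For the order in which \<open>x\<close> is below \<open>s\<close> if \<open>x / s \<in> V\<close>, this is a greatest element; in terms of
  the valuation it is an element of least value.
\<close>

lemma dominant_element:
  assumes "finite S" "S \<noteq> {}" "0 \<notin> S"
  shows "\<exists>s\<in>S. \<forall>x\<in>S. x / s \<in> V"
  using assms
proof (induction S rule: finite_ne_induct)
  case (singleton x)
  then show ?case using subring_1[OF subring_V] by auto
next
  case (insert y S)
  then obtain s where s: "s \<in> S" "\<forall>x\<in>S. x / s \<in> V" by auto
  have nz: "s \<noteq> 0" "y \<noteq> 0" using insert.prems s by auto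
  show ?case
  proof (cases "y / s \<in> V")
    case True
    then show ?thesis using s by auto
  next
    case False
    then have "s / y \<in> V" using pole[of "y / s"] by simp
    moreover have "x / y = (x / s) * (s / y)" for x using nz by simp
    ultimately have "\<forall>x\<in>S. x / y \<in> V" using s subring_mult[OF subring_V] by metis
    then show ?thesis using nz subring_1[OF subring_V] by auto
  qed
qed

text \<open>
  Dividing \<open>p(r)\<close> by a coefficient \<open>h\<close> of least value leaves a polynomial whose reduction over \<open>D\<close> is
  nonzero, having a coefficient \<open>1\<close>. As the residue of \<open>r\<close> is transcendental over \<open>D\<close>, it does not
  vanish there. Thus the value of \<open>p(r)\<close> is the least value of its coefficients, as for a Gauss
  valuation. In the application \<open>H\<close> consists of polynomials of bounded degree, where no
  control over products is available but quotients have their residues in \<open>D\<close>.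
\<close>

lemma poly_transcendental_residue:
  assumes H: "0 \<in> H"
    and quot: "\<And>h h'. h \<in> H \<Longrightarrow> h' \<in> H \<Longrightarrow> h' \<noteq> 0 \<Longrightarrow> h / h' \<in> V \<Longrightarrow> \<rho> (h / h') \<in> D"
    and r: "r \<in> V" "\<not> algebraic_over D (\<rho> r)"
    and p: "p \<in> polys_over H" "p \<noteq> 0"
  shows "\<exists>h\<in>H. \<exists>q\<in>polys_over D. h \<noteq> 0 \<and> poly p r / h \<in> V \<and>
           \<rho> (poly p r / h) = poly q (\<rho> r) \<and> \<rho> (poly p r / h) \<noteq> 0"
proof -
  define S where "S = coeff p ` {i. coeff p i \<noteq> 0}"
  have "{i. coeff p i \<noteq> 0} \<subseteq> {..degree p}" by (auto intro: le_degree)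
  then have "finite S" unfolding S_def using finite_subset by blast
  moreover have "S \<noteq> {}" "0 \<notin> S" using p(2) unfolding S_def by (auto simp: poly_eq_iff)
  ultimately obtain h where h: "h \<in> S" "\<forall>x\<in>S. x / h \<in> V" using dominant_element by blast
  obtain j where j: "h = coeff p j" "h \<noteq> 0" using h(1) S_def by blast
  have hH: "h \<in> H" using polys_overD[OF p(1)] j(1) by simp
  define p' where "p' = smult (inverse h) p"
  have c: "coeff p' i = coeff p i / h" for i by (simp add: p'_def field_simps)
  have cV: "coeff p' i \<in> V" for i
    using h(2) subring_0[OF subring_V] by (cases "coeff p i = 0") (auto simp: c S_def)
  then have p'V: "p' \<in> polys_over V" by (rule polys_overI)
  define q where "q = map_poly \<rho> p'"
  have cq: "coeff q i = \<rho> (coeff p' i)" for i by (simp add: q_def coeff_map_poly res_0)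
  have "q \<in> polys_over D"
    using quot[OF polys_overD[OF p(1)] hH j(2)] cV c cq by (intro polys_overI) simp
  moreover have "q \<noteq> 0"
  proof -
    have "coeff q j = 1" using j by (simp add: cq c res_1)
    then show ?thesis by auto
  qed
  ultimately have "poly q (\<rho> r) \<noteq> 0" using r(2) unfolding algebraic_over_iff by blast
  moreover have "poly p r / h = poly p' r" by (simp add: p'_def field_simps)
  ultimately have "poly p r / h \<in> V" "\<rho> (poly p r / h) = poly q (\<rho> r)" "\<rho> (poly p r / h) \<noteq> 0"
    using poly_res[OF p'V r(1)] unfolding q_def by simp_all
  then show ?thesis using hH j(2) \<open>q \<in> polys_over D\<close> by blast
qed

end

lemma mult_polys_over_module:
  assumes "0 \<in> H" "\<And>x y. x \<in> H \<Longrightarrow> y \<in> H \<Longrightarrow> x + y \<in> H"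
    and "\<And>a x. a \<in> K \<Longrightarrow> x \<in> H \<Longrightarrow> a * x \<in> H"
    and "p \<in> polys_over K" "q \<in> polys_over H"
  shows "p * q \<in> polys_over H"
proof (rule polys_overI)
  fix n
  have sum: "sum f I \<in> H" if "\<And>i. i \<in> I \<Longrightarrow> f i \<in> H" for f :: "nat \<Rightarrow> 'a" and I
    using that by (induction I rule: infinite_finite_induct) (auto simp: assms)
  show "coeff (p * q) n \<in> H"
    unfolding coeff_mult using assms(3)[OF polys_overD[OF assms(4)] polys_overD[OF assms(5)]]
    by (intro sum)
qed

text \<open>
  The equation \<open>f(X) - r g(X) = 0\<close> for \<open>t\<close> over \<open>K(r)\<close>; it is nontrivial since otherwise \<open>r\<close> would be
  the quotient of two coefficients.
\<close>

lemma rational_generator_algebraic: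
  fixes t :: "'a::field"
  assumes K: "is_subfield K" and f: "f \<in> polys_over K" "degree f \<le> n" and g: "g \<in> polys_over K" "degree g \<le> n"
    and "poly g t \<noteq> 0" and r: "r = poly f t / poly g t" "r \<notin> K"
  shows "\<exists>p\<in>polys_over (field_adjoin K {r}). p \<noteq> 0 \<and> degree p \<le> n \<and> poly p t = 0"
proof (intro bexI conjI)
  let ?p = "f - smult r g" and ?E = "field_adjoin K {r}"
  have E: "is_subring ?E" "K \<subseteq> ?E" "r \<in> ?E"
    using subfield_subring[OF subfield_field_adjoin] field_adjoin_superset[of K "{r}"] by auto
  show "?p \<in> polys_over ?E"
    using polys_over_mono[OF E(2) f(1)] polys_over_mono[OF E(2) g(1)]
    by (intro subring_diff[OF subring_polys_over[OF E(1)]] smult_polys_over[OF E(1) E(3)])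
  show "?p \<noteq> 0"
  proof
    assume "?p = 0"
    then have eq: "coeff f i = r * coeff g i" for i by (metis coeff_smult right_minus_eq)
    have "g \<noteq> 0" using assms(6) by auto
    have "r = coeff f (degree g) / coeff g (degree g)" using eq[of "degree g"] \<open>g \<noteq> 0\<close> by simp
    then show False using r(2) subfield_divide[OF K polys_overD[OF f(1)] polys_overD[OF g(1)]] by metis
  qed
  show "degree ?p \<le> n" using f(2) g(2) by (intro degree_diff_le) (auto intro: order_trans[OF degree_smult_le])
  show "poly ?p t = 0" using r(1) assms(6) by simp
qed

text \<open>
  \<open>K(r)[t]\<close> is a field containing \<open>K\<close> and \<open>t\<close>, hence everything, and the equation \<open>p\<close> bounds the powers of \<open>t\<close>.
\<close>

lemma simple_extension_over_subextension:
  fixes t r :: "'a::field"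
  assumes K: "is_subfield K" and gen: "field_adjoin K {t} = UNIV"
    and p: "p \<in> polys_over (field_adjoin K {r})" "p \<noteq> 0" "degree p \<le> n" "poly p t = 0"
  shows "lin_span (field_adjoin K {r}) {t ^ i | i. i < n} = UNIV"
proof -
  let ?E = "field_adjoin K {r}"
  have E: "is_subfield ?E" "is_subring ?E"
    using subfield_subring[OF subfield_field_adjoin] subfield_field_adjoin by blast+
  have "algebraic_over ?E t" using p unfolding algebraic_over_iff by blast
  then have "field_adjoin K {t} \<subseteq> ring_adjoin ?E t"
    using ring_adjoin_base[OF E(2)] ring_adjoin_gen[OF E(2)] field_adjoin_superset[of K "{r}"]
    by (intro field_adjoin_minimal ring_adjoin_algebraic_subfield[OF E(1)]) blast+
  also have "\<dots> \<subseteq> lin_span ?E {t ^ i | i. i < degree p}"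
    using ring_adjoin_subset_span[OF E(1) p(1,2,4)] .
  also have "\<dots> \<subseteq> lin_span ?E {t ^ i | i. i < n}"
    using p(3) by (intro subsetI, elim lin_span_mono[rotated]) auto
  finally show ?thesis using gen by blast
qed

text \<open>
  Elements of the \<open>K(r)\<close>-span of a \<open>K\<close>-subspace \<open>H\<close>, over a common denominator, become polynomials in
  \<open>r\<close> with coefficients in \<open>H\<close>. The denominator has its coefficients in \<open>K\<close>.
\<close>

lemma span_over_rational_as_quotient:
  fixes t r :: "'a::field"
  assumes K: "is_subfield K"
    and H: "0 \<in> H" "\<And>x y. x \<in> H \<Longrightarrow> y \<in> H \<Longrightarrow> x + y \<in> H"
      "\<And>a x. a \<in> K \<Longrightarrow> x \<in> H \<Longrightarrow> a * x \<in> H"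
    and y: "y \<in> lin_span (field_adjoin K {r}) H"
  shows "\<exists>p\<in>polys_over H. \<exists>d\<in>polys_over K. poly d r \<noteq> 0 \<and> y = poly p r / poly d r"
  using y
proof induction
  case lin_span_0
  show ?case using H(1) subring_1[OF subring_polys_over[OF subfield_subring[OF K]]]
    by (intro bexI[of _ 0] bexI[of _ 1]) (auto simp: polys_over_def)
next
  case (lin_span_step c w s)
  obtain p d where pd: "p \<in> polys_over H" "d \<in> polys_over K" "poly d r \<noteq> 0" "s = poly p r / poly d r"
    using lin_span_step by blast
  obtain a b where ab: "a \<in> polys_over K" "b \<in> polys_over K" "poly b r \<noteq> 0" "c = poly a r / poly b r"
    using field_adjoin_singleE[OF K lin_span_step(1)] by blast
  note P = subring_polys_over[OF subfield_subring[OF K]]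
  have mod: "e * q \<in> polys_over H" if "e \<in> polys_over K" "q \<in> polys_over H" for e q
    by (rule mult_polys_over_module[OF H that])
  have w: "[:w:] \<in> polys_over H"
    using lin_span_step(2) H(1) by (intro pCons_polys_over) (auto simp: polys_over_def)
  have "a * d * [:w:] \<in> polys_over H" by (rule mod[OF subring_mult[OF P ab(1) pd(2)] w])
  moreover have "b * p \<in> polys_over H" by (rule mod[OF ab(2) pd(1)])
  ultimately have "a * d * [:w:] + b * p \<in> polys_over H"
    by (auto intro!: polys_overI H(2) dest: polys_overD simp del: mult_pCons_right)
  moreover have "b * d \<in> polys_over K" using ab pd by (intro subring_mult[OF P])
  moreover have "poly (b * d) r \<noteq> 0" using ab pd by simp
  moreover have "c * w + s = poly (a * d * [:w:] + b * p) r / poly (b * d) r"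
    using ab pd by (simp add: field_simps)
  ultimately show ?case by blast
qed

context field_place
begin

text \<open>
  Among all representations \<open>f(t) / g(t)\<close> of elements with transcendental residue choose one, called
  \<open>r\<close>, that minimises the larger of the two degrees, say \<open>n\<close>. Then those quotients of elements
  of \<open>H = {h(t). degree h < n}\<close> that lie in \<open>V\<close> have residues in \<open>D\<close>. On the other hand
  \<open>t\<close> has degree at most \<open>n\<close> over \<open>K(r)\<close>, so \<open>H\<close> spans the whole field over \<open>K(r)\<close> and every element is a quotient \<open>p(r) / d(r)\<close> of
  polynomials with coefficients in \<open>H\<close>. By \<open>poly_transcendental_residue\<close> its residue is
  then a quotient of elements of \<open>D\<close> and values of polynomials over \<open>D\<close> at the residue of \<open>r\<close>.
\<close>

lemma ruled_residue_field:
  assumes K: "is_subfield K" and gen: "field_adjoin K {t} = UNIV"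
    and c: "c \<in> V" "\<rho> c \<notin> alg_elements (residues K)"
  defines "D \<equiv> \<rho> ` V \<inter> alg_elements (residues K)"
  shows "\<exists>r. \<not> algebraic_over D r \<and> \<rho> ` V = field_adjoin D {r}"
proof -
  note RK = subfield_subring[OF K]
  define P where "P n \<longleftrightarrow> (\<exists>f\<in>polys_over K. \<exists>g\<in>polys_over K. degree f \<le> n \<and> degree g \<le> n \<and>
     poly g t \<noteq> 0 \<and> poly f t / poly g t \<in> V \<and> \<rho> (poly f t / poly g t) \<notin> alg_elements (residues K))" for n
  have "\<exists>n. P n"
  proof -
    obtain f g where fg: "f \<in> polys_over K" "g \<in> polys_over K" "poly g t \<noteq> 0" "c = poly f t / poly g t"
      using field_adjoin_singleE[OF K, of c t] gen by blast
    then have "P (max (degree f) (degree g))" unfolding P_def using c by (auto intro!: bexI)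
    then show ?thesis by blast
  qed
  define n where "n = (LEAST n. P n)"
  have "P n" unfolding n_def using \<open>\<exists>n. P n\<close> by (rule LeastI_ex)
  then obtain f g where fg: "f \<in> polys_over K" "g \<in> polys_over K" "degree f \<le> n" "degree g \<le> n"
      "poly g t \<noteq> 0" and res: "poly f t / poly g t \<in> V" "\<rho> (poly f t / poly g t) \<notin> alg_elements (residues K)"
    unfolding P_def by blast
  define r where "r = poly f t / poly g t"
  have sRK: "is_subfield (residues K)" by (rule subfield_residues[OF K])
  have "r \<notin> K"
  proof
    assume "r \<in> K"
    then have "\<rho> r \<in> residues K" using res(1) unfolding r_def residues_def by blast
    then show False using res(2) alg_elements_base[OF sRK] r_def by blast
  qed
  have "n \<noteq> 0"
  proof
    assume "n = 0"
    then obtain a b where "f = [:a:]" "g = [:b:]" using fg by (metis degree_eq_zeroE le_zero_eq)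
    then have "r \<in> K" using subfield_divide[OF K polys_overD[OF fg(1), of 0] polys_overD[OF fg(2), of 0]]
      by (simp add: r_def)
    then show False using \<open>r \<notin> K\<close> by simp
  qed
  define H where "H = {poly h t | h. h \<in> polys_over K \<and> degree h < n}"
  have KH: "K \<subseteq> H"
  proof
    fix a assume "a \<in> K"
    then have "[:a:] \<in> polys_over K" "degree [:a:] < n" "a = poly [:a:] t"
      using const_polys_over[OF RK] \<open>n \<noteq> 0\<close> by auto
    then show "a \<in> H" unfolding H_def by blast
  qed
  have H0: "0 \<in> H" using KH subring_0[OF RK] by blast
  have Hadd: "x + y \<in> H" if xy: "x \<in> H" "y \<in> H" for x y
  proof -
    obtain h h' where h: "h \<in> polys_over K" "degree h < n" "x = poly h t"
      "h' \<in> polys_over K" "degree h' < n" "y = poly h' t" using xy unfolding H_def by blast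
    have "h + h' \<in> polys_over K" using h by (intro subring_add[OF subring_polys_over[OF RK]])
    then show ?thesis unfolding H_def using h degree_add_less[of h n h'] by force
  qed
  have Hscale: "a * x \<in> H" if ax: "a \<in> K" "x \<in> H" for a x
  proof -
    obtain h where h: "h \<in> polys_over K" "degree h < n" "x = poly h t" using ax unfolding H_def by blast
    have "smult a h \<in> polys_over K" using h ax by (intro smult_polys_over[OF RK])
    moreover have "degree (smult a h) < n" using degree_smult_le h(2) by (rule le_less_trans)
    moreover have "a * x = poly (smult a h) t" using h by simp
    ultimately show ?thesis unfolding H_def by blast
  qed
  have quot: "\<rho> (h / h') \<in> D" if hh: "h \<in> H" "h' \<in> H" "h' \<noteq> 0" "h / h' \<in> V" for h h'
  proof (rule ccontr)
    assume "\<rho> (h / h') \<notin> D"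
    then have no: "\<rho> (h / h') \<notin> alg_elements (residues K)" using hh unfolding D_def by blast
    obtain u w where "u \<in> polys_over K" "degree u < n" "h = poly u t"
      "w \<in> polys_over K" "degree w < n" "h' = poly w t" using hh unfolding H_def by blast
    then have "P (n - 1)" unfolding P_def using no hh by (intro bexI[of _ u] bexI[of _ w]) auto
    then have "n \<le> n - 1" unfolding n_def by (rule Least_le)
    then show False using \<open>n \<noteq> 0\<close> by simp
  qed
  have subD: "is_subfield D"
  proof -
    have "residues UNIV = \<rho> ` V" unfolding residues_def by simp
    then have "is_subfield (\<rho> ` V)"
      using subfield_residues[of UNIV] by (simp add: is_subfield_def is_subring_def)
    then show ?thesis
      using subfield_alg_elements[OF sRK] unfolding D_def is_subfield_def is_subring_def by auto
  qed
  have rV: "r \<in> V" using res unfolding r_def by simp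
  have trans: "\<not> algebraic_over D (\<rho> r)"
  proof
    assume "algebraic_over D (\<rho> r)"
    then have "algebraic_over (alg_elements (residues K)) (\<rho> r)"
      using algebraic_over_mono unfolding D_def by blast
    then show False using alg_elements_idem[OF sRK] res(2) unfolding r_def by blast
  qed
  let ?L = "field_adjoin D {\<rho> r}"
  have L: "is_subring ?L" "is_subfield ?L" "D \<subseteq> ?L" "\<rho> r \<in> ?L"
    using subfield_subring[OF subfield_field_adjoin] subfield_field_adjoin field_adjoin_superset[of D "{\<rho> r}"]
    by auto
  \<comment> \<open>With \<open>u = p(r) / h\<close> and \<open>u' = d(r) / h'\<close> of nonzero residue, \<open>y = (h / h') * (u / u')\<close> and each
      factor has a residue in \<open>D(\<rho> r)\<close>.\<close>
  have "\<rho> y \<in> ?L" if "y \<in> V" for y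
  proof (cases "\<rho> y = 0")
    case True
    then show ?thesis using subring_0[OF L(1)] by simp
  next
    case False
    then have "y \<noteq> 0" using res_0 by auto
    obtain m where m: "m \<in> polys_over (field_adjoin K {r})" "m \<noteq> 0" "degree m \<le> n" "poly m t = 0"
      using rational_generator_algebraic[OF K fg(1,3,2,4,5) r_def \<open>r \<notin> K\<close>] by blast
    have powers: "{t ^ i | i. i < n} \<subseteq> H"
    proof safe
      fix i assume "i < n"
      then have "degree (monom 1 i :: 'a poly) < n" "t ^ i = poly (monom 1 i) t"
        by (auto simp: degree_monom_eq poly_monom)
      then show "t ^ i \<in> H"
        unfolding H_def using monom_polys_over[OF RK subring_1[OF RK], of i] by blast
    qed
    have "y \<in> lin_span (field_adjoin K {r}) H"
      using simple_extension_over_subextension[OF K gen m] lin_span_mono[OF powers] by blast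
    then obtain p d where pd: "p \<in> polys_over H" "d \<in> polys_over K" "poly d r \<noteq> 0" "y = poly p r / poly d r"
      using span_over_rational_as_quotient[OF K H0 Hadd Hscale] by blast
    have "p \<noteq> 0" "d \<noteq> 0" using pd \<open>y \<noteq> 0\<close> by auto
    obtain h q where h: "h \<in> H" "q \<in> polys_over D" "h \<noteq> 0" "poly p r / h \<in> V"
        "\<rho> (poly p r / h) = poly q (\<rho> r)" "\<rho> (poly p r / h) \<noteq> 0"
      using poly_transcendental_residue[OF H0 quot rV trans pd(1) \<open>p \<noteq> 0\<close>] by blast
    obtain h' q' where h': "h' \<in> H" "q' \<in> polys_over D" "h' \<noteq> 0" "poly d r / h' \<in> V"
        "\<rho> (poly d r / h') = poly q' (\<rho> r)" "\<rho> (poly d r / h') \<noteq> 0"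
      using poly_transcendental_residue[OF H0 quot rV trans polys_over_mono[OF KH pd(2)] \<open>d \<noteq> 0\<close>] by blast
    define u u' where "u = poly p r / h" and "u' = poly d r / h'"
    have uV: "u \<in> V" "u' \<in> V" "inverse u \<in> V" "inverse u' \<in> V"
      using h h' unit_inverse unfolding u_def u'_def by blast+
    have "poly p r \<noteq> 0" using h res_0 by auto
    then have "h / h' = y * u' * inverse u" and y_eq: "y = (h / h') * (u * inverse u')"
      using h(3) h'(3) pd unfolding u_def u'_def by (simp_all add: field_simps)
    then have hV: "h / h' \<in> V" using uV \<open>y \<in> V\<close> subring_mult[OF subring_V] by metis
    have "\<rho> y = \<rho> (h / h') * (\<rho> u * \<rho> (inverse u'))"
      unfolding y_eq using hV uV by (simp add: res_mult subring_mult[OF subring_V] del: times_divide_eq_left)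
    also have "\<dots> = \<rho> (h / h') * (poly q (\<rho> r) * inverse (poly q' (\<rho> r)))"
      using res_inverse[of u'] h h' unfolding u_def u'_def by simp
    also have "\<dots> \<in> ?L"
      using quot[OF h(1) h'(1,3) hV] L(3) h(2) h'(2) L(4)
      by (intro subring_mult[OF L(1)] subfield_inverse[OF L(2)] poly_mem_subring[OF L(1)]
          polys_over_mono[OF L(3)]) auto
    finally show ?thesis .
  qed
  moreover have "?L \<subseteq> \<rho> ` V"
  proof (rule field_adjoin_minimal)
    show "is_subfield (\<rho> ` V)"
      using subfield_residues[of UNIV] by (simp add: is_subfield_def is_subring_def residues_def)
    show "D \<subseteq> \<rho> ` V" unfolding D_def by blast
    show "{\<rho> r} \<subseteq> \<rho> ` V" using rV by blast
  qed
  ultimately show ?thesis using trans by (intro exI[of _ "\<rho> r"]) blast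
qed

end

section \<open>The place of a rational function field at zero\<close>

text \<open>
  The place \<open>u = 0\<close> of \<open>K(u)\<close>: its valuation ring consists of the quotients whose denominator has
  nonzero constant term, and the residue is the quotient of the constant terms. The value
  does not depend on the representation because \<open>u\<close> is transcendental.
\<close>

lemma place_at_zero:
  fixes u :: "'a::field"
  assumes K: "is_subfield K" and trans: "\<not> algebraic_over K u" and gen: "field_adjoin K {u} = UNIV"
  obtains V \<rho> where "field_place V \<rho>" "\<rho> ` V \<subseteq> K"
    "\<And>p q. p \<in> polys_over K \<Longrightarrow> q \<in> polys_over K \<Longrightarrow> coeff q 0 \<noteq> 0 \<Longrightarrow>
       poly p u / poly q u \<in> V \<and> \<rho> (poly p u / poly q u) = coeff p 0 / coeff q 0"
proof -
  note R = subfield_subring[OF K]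
  note P = subring_polys_over[OF R]
  have nz: "poly q u \<noteq> 0" if "q \<in> polys_over K" "q \<noteq> 0" for q
    using trans that unfolding algebraic_over_iff by blast
  define rep where "rep x p q \<longleftrightarrow> p \<in> polys_over K \<and> q \<in> polys_over K \<and> coeff q 0 \<noteq> 0 \<and> x = poly p u / poly q u"
    for x p q
  have unique: "coeff p 0 / coeff q 0 = coeff p' 0 / coeff q' 0" if "rep x p q" "rep x p' q'" for x p q p' q'
  proof -
    have k: "p \<in> polys_over K" "q \<in> polys_over K" "p' \<in> polys_over K" "q' \<in> polys_over K"
      and q0: "coeff q 0 \<noteq> 0" "coeff q' 0 \<noteq> 0" and x: "poly p u / poly q u = poly p' u / poly q' u"
      using that unfolding rep_def by auto
    have "poly q u \<noteq> 0" "poly q' u \<noteq> 0" using nz[OF k(2)] nz[OF k(4)] q0 by force+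
    then have "poly (p * q' - p' * q) u = 0" using x by (simp add: field_simps)
    moreover have "p * q' - p' * q \<in> polys_over K"
      using k by (intro subring_diff[OF P] subring_mult[OF P])
    ultimately have "p * q' - p' * q = 0" using nz by blast
    then have "coeff (p * q') 0 = coeff (p' * q) 0" by simp
    then show ?thesis using q0 by (simp add: coeff_mult_0 field_simps)
  qed
  define V where "V = {x. \<exists>p q. rep x p q}"
  define \<rho> where "\<rho> x = (THE c. \<exists>p q. rep x p q \<and> c = coeff p 0 / coeff q 0)" for x
  have rho: "x \<in> V \<and> \<rho> x = coeff p 0 / coeff q 0" if "rep x p q" for x p q
  proof
    show "x \<in> V" using that V_def by blast
    show "\<rho> x = coeff p 0 / coeff q 0"
      unfolding \<rho>_def using that unique by (intro the_equality) blast+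
  qed
  have "field_place V \<rho>"
  proof
    have "rep 1 1 1" unfolding rep_def using subring_1[OF P] by simp
    then have one: "1 \<in> V" "\<rho> 1 = 1" using rho[of 1 1 1] by auto
    then show "\<rho> 1 = 1" by simp
    have ops: "x + y \<in> V \<and> x - y \<in> V \<and> x * y \<in> V \<and> \<rho> (x + y) = \<rho> x + \<rho> y \<and> \<rho> (x * y) = \<rho> x * \<rho> y"
      if xy: "x \<in> V" "y \<in> V" for x y
    proof -
      obtain p q p' q' where pq: "rep x p q" "rep y p' q'" using xy unfolding V_def by blast
      then have k: "p \<in> polys_over K" "q \<in> polys_over K" "p' \<in> polys_over K" "q' \<in> polys_over K"
        and q0: "coeff q 0 \<noteq> 0" "coeff q' 0 \<noteq> 0" unfolding rep_def by auto
      have qu: "poly q u \<noteq> 0" "poly q' u \<noteq> 0" using nz[OF k(2)] nz[OF k(4)] q0 by force+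
      have "rep (x + y) (p * q' + p' * q) (q * q')"
        using pq qu k q0 unfolding rep_def
        by (auto simp: coeff_mult_0 add_frac_eq intro!: subring_add[OF P] subring_mult[OF P])
      moreover have "rep (x - y) (p * q' - p' * q) (q * q')"
        using pq qu k q0 unfolding rep_def
        by (auto simp: coeff_mult_0 diff_frac_eq intro!: subring_diff[OF P] subring_mult[OF P])
      moreover have "rep (x * y) (p * p') (q * q')"
        using pq qu k q0 unfolding rep_def
        by (auto simp: coeff_mult_0 intro!: subring_mult[OF P])
      ultimately show ?thesis
        using rho[OF pq(1)] rho[OF pq(2)] rho q0 by (force simp: coeff_mult_0 add_frac_eq)
    qed
    show "is_subring V" unfolding is_subring_def using one ops by blast
    show "\<rho> (x + y) = \<rho> x + \<rho> y" "\<rho> (x * y) = \<rho> x * \<rho> y" if "x \<in> V" "y \<in> V" for x y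
      using ops that by auto
    fix x assume x: "x \<notin> V"
    obtain p q where pq: "p \<in> polys_over K" "q \<in> polys_over K" "poly q u \<noteq> 0" "x = poly p u / poly q u"
      using field_adjoin_singleE[OF K, of x u] gen by blast
    \<comment> \<open>Cancel the common power of \<open>u\<close>.\<close>
    then have "\<exists>p\<in>polys_over K. \<exists>q\<in>polys_over K. poly q u \<noteq> 0 \<and> x = poly p u / poly q u \<and>
        (coeff p 0 \<noteq> 0 \<or> coeff q 0 \<noteq> 0)"
    proof (induction q arbitrary: p)
      case (pCons a q)
      show ?case
      proof (cases "coeff p 0 = 0 \<and> a = 0")
        case True
        obtain p' where p': "p = pCons 0 p'" using True by (cases p) auto
        have "u \<noteq> 0" using pCons.prems True by auto
        have "p' \<in> polys_over K" "q \<in> polys_over K"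
          using pCons.prems p' pCons_polys_overD by blast+
        then show ?thesis using pCons.IH[of p'] pCons.prems p' True \<open>u \<noteq> 0\<close> by auto
      next
        case False
        then have "coeff p 0 \<noteq> 0 \<or> coeff (pCons a q) 0 \<noteq> 0" by simp
        then show ?thesis using pCons.prems by blast
      qed
    qed simp
    then obtain p q where pq: "p \<in> polys_over K" "q \<in> polys_over K" "poly q u \<noteq> 0"
      "x = poly p u / poly q u" "coeff p 0 \<noteq> 0 \<or> coeff q 0 \<noteq> 0" by blast
    have q0: "coeff q 0 = 0" using x pq unfolding V_def rep_def by blast
    then have "rep (inverse x) q p" using pq unfolding rep_def by simp
    from rho[OF this] show "inverse x \<in> V \<and> \<rho> (inverse x) = 0" using q0 by simp
  qed
  moreover have "\<rho> ` V \<subseteq> K"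
  proof safe
    fix x assume "x \<in> V"
    then obtain p q where "rep x p q" unfolding V_def by blast
    then show "\<rho> x \<in> K"
      using rho[of x p q] subfield_divide[OF K polys_overD polys_overD] unfolding rep_def by metis
  qed
  ultimately show thesis using that rho unfolding rep_def by blast
qed

section \<open>Transcendence degree of residue fields\<close>

context field_place
begin

text \<open>
  On a field contained in the valuation ring the residue map is injective. Hence a polynomial relation
  for \<open>z\<close> over \<open>E\<close> would reduce to a nontrivial one for its residue, and nonzero polynomial expressions in
  \<open>z\<close> are units of \<open>V\<close>.
\<close>

lemma transcendental_lift:
  assumes E: "is_subfield E" "E \<subseteq> V" and E': "\<rho> ` E \<subseteq> E'"
    and z: "z \<in> V" "\<not> algebraic_over E' (\<rho> z)"
  shows "\<not> algebraic_over E z" "field_adjoin E {z} \<subseteq> V"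
    "\<rho> ` field_adjoin E {z} \<subseteq> field_adjoin E' {\<rho> z}"
proof -
  have map: "map_poly \<rho> q \<in> polys_over E'" if "q \<in> polys_over E" for q
    using E' polys_overD[OF that] by (intro polys_overI) (auto simp: coeff_map_poly res_0)
  have nz: "\<rho> (poly q z) \<noteq> 0" if q: "q \<in> polys_over E" "q \<noteq> 0" for q
  proof -
    have "\<rho> (lead_coeff q) \<noteq> 0"
      using res_nonzero_on_subfield[OF E polys_overD[OF q(1)]] q(2) by simp
    then have "coeff (map_poly \<rho> q) (degree q) \<noteq> 0" by (simp add: coeff_map_poly res_0)
    then have "map_poly \<rho> q \<noteq> 0" by auto
    then show ?thesis
      using z(2) map[OF q(1)] poly_res(2)[OF polys_over_mono[OF E(2) q(1)] z(1)]
      unfolding algebraic_over_iff by auto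
  qed
  show "\<not> algebraic_over E z"
    using nz res_0 unfolding algebraic_over_iff by metis
  have "y \<in> V \<and> \<rho> y \<in> field_adjoin E' {\<rho> z}" if "y \<in> field_adjoin E {z}" for y
  proof -
    obtain p q where pq: "p \<in> polys_over E" "q \<in> polys_over E" "poly q z \<noteq> 0" "y = poly p z / poly q z"
      using field_adjoin_singleE[OF E(1) \<open>y \<in> _\<close>] by blast
    have q: "poly q z \<in> V" "\<rho> (poly q z) \<noteq> 0"
      using nz[OF pq(2)] pq(3) poly_res(1)[OF polys_over_mono[OF E(2) pq(2)] z(1)] by fastforce+
    have p: "poly p z \<in> V" using poly_res(1)[OF polys_over_mono[OF E(2) pq(1)] z(1)] .
    let ?L = "field_adjoin E' {\<rho> z}"
    have L: "is_subring ?L" "E' \<subseteq> ?L" "\<rho> z \<in> ?L"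
      using subfield_subring[OF subfield_field_adjoin] field_adjoin_superset[of E' "{\<rho> z}"] by auto
    have mem: "\<rho> (poly h z) \<in> ?L" if "h \<in> polys_over E" for h
      using poly_mem_subring[OF L(1) polys_over_mono[OF L(2) map[OF that]] L(3)]
        poly_res(2)[OF polys_over_mono[OF E(2) that] z(1)] by simp
    have "y = poly p z * inverse (poly q z)" using pq(4) by (simp add: divide_inverse)
    then have "y \<in> V" "\<rho> y = \<rho> (poly p z) * inverse (\<rho> (poly q z))"
      using p unit_inverse[OF q] res_inverse[OF q] by (simp_all add: res_mult subring_mult[OF subring_V])
    then show ?thesis
      using mem[OF pq(1)] subfield_inverse[OF subfield_field_adjoin mem[OF pq(2)]] subring_mult[OF L(1)]
      by auto
  qed
  then show "field_adjoin E {z} \<subseteq> V" "\<rho> ` field_adjoin E {z} \<subseteq> field_adjoin E' {\<rho> z}" by blast+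
qed

text \<open>
  Lifts of independent residues are independent. The two inclusions keep the induction going.
\<close>

lemma alg_indep_list_lift:
  assumes k: "is_subfield k" "k \<subseteq> V" "\<rho> ` k \<subseteq> k'"
    and "set zs \<subseteq> V" "alg_indep_list k' (map \<rho> zs)"
  shows "alg_indep_list k zs \<and> field_adjoin k (set zs) \<subseteq> V \<and>
         \<rho> ` field_adjoin k (set zs) \<subseteq> field_adjoin k' (\<rho> ` set zs)"
  using assms(4,5)
proof (induction zs)
  case Nil
  have "field_adjoin k {} \<subseteq> k" using k(1) by (intro field_adjoin_minimal) auto
  then show ?case using k(2,3) field_adjoin_superset[of k' "{}"] by auto
next
  case (Cons z zs)
  then have IH: "alg_indep_list k zs" "field_adjoin k (set zs) \<subseteq> V"
      "\<rho> ` field_adjoin k (set zs) \<subseteq> field_adjoin k' (\<rho> ` set zs)" by auto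
  have "\<not> algebraic_over (field_adjoin k' (\<rho> ` set zs)) (\<rho> z)"
    using Cons.prems(2) by (simp add: alg_span_def alg_elements_def)
  from transcendental_lift[OF subfield_field_adjoin IH(2,3) _ this]
  show ?case
    using Cons.prems(1) IH(1)
    by (simp add: alg_span_def alg_elements_def field_adjoin_insert[of k z] field_adjoin_insert[of k' "\<rho> z"])
qed

text \<open>
  In a relation for \<open>b\<close> with nonzero constant term, reduction kills everything but that term.
\<close>

lemma transcendental_of_zero_residue:
  assumes E: "is_subfield E" "E \<subseteq> V" and b: "b \<in> V" "\<rho> b = 0" "b \<noteq> 0"
  shows "\<not> algebraic_over E b"
proof
  assume "algebraic_over E b"
  then obtain p where p: "p \<in> polys_over E" "coeff p 0 \<noteq> 0" "poly p b = 0"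
    using algebraic_over_nonzero_constE[OF _ b(3)] by blast
  have "poly (map_poly \<rho> p) 0 = 0"
    using poly_res(2)[OF polys_over_mono[OF E(2) p(1)] b(1)] p(3) b(2) res_0 by simp
  then have "\<rho> (coeff p 0) = 0" by (simp add: poly_0_coeff_0 coeff_map_poly res_0)
  then show False using res_nonzero_on_subfield[OF E polys_overD[OF p(1)] p(2)] by simp
qed

end

text \<open>
  A case of Abhyankar's inequality. Suppose \<open>K\<close> were algebraic over the residue field of \<open>K'\<close>, and let
  \<open>ys\<close> be a transcendence basis of that residue field over \<open>k\<close>. Then \<open>ys\<close> together with \<open>t\<close> spans the
  whole field. But lifts \<open>zs\<close> of \<open>ys\<close> to \<open>K'\<close>, the element \<open>b\<close> of residue \<open>0\<close>, and \<open>t'\<close> form an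
  independent family with one element more.
\<close>

lemma residue_field_not_algebraic:
  fixes \<rho> :: "'a::field \<Rightarrow> 'a"
  assumes pl: "field_place V \<rho>"
    and K: "is_subfield K" "K \<subseteq> V" "\<And>x. x \<in> K \<Longrightarrow> \<rho> x = x" and gen: "field_adjoin K {t} = UNIV"
    and K': "is_subfield K'" and t': "\<not> algebraic_over K' t'"
    and k: "is_subfield k" "k \<subseteq> K" "k \<subseteq> K'"
    and fin: "finite S" "alg_span k S = UNIV"
    and b: "b \<in> K'" "b \<in> V" "b \<noteq> 0" "\<rho> b = 0"
  shows "\<exists>c\<in>K. c \<notin> alg_elements (field_place.residues V \<rho> K')"
proof (rule ccontr)
  interpret field_place V \<rho> by (rule pl)
  assume "\<not> ?thesis"
  then have alg: "K \<subseteq> alg_elements (residues K')" by blast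
  \<comment> \<open>A basis is found as an independent list of greatest length; lengths are bounded by \<open>card S\<close>.\<close>
  define Q where "Q n \<longleftrightarrow> (\<exists>ys. set ys \<subseteq> residues K' \<and> alg_indep_list k ys \<and> length ys = n)" for n
  have "Q 0" unfolding Q_def by auto
  moreover have bound: "\<forall>n. Q n \<longrightarrow> n \<le> card S" using alg_indep_length_le fin unfolding Q_def by blast
  ultimately obtain n where n: "Q n" "\<And>m. Q m \<Longrightarrow> m \<le> n"
    using GreatestI_nat[of Q 0 "card S"] Greatest_le_nat[of Q _ "card S"] by blast
  then obtain ys where ys: "set ys \<subseteq> residues K'" "alg_indep_list k ys" "length ys = n"
    unfolding Q_def by blast
  have "residues K' \<subseteq> alg_span k (set ys)"
  proof (rule ccontr)
    assume "\<not> ?thesis"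
    then obtain y where "y \<in> residues K'" "y \<notin> alg_span k (set ys)" by blast
    then have "Q (Suc n)" unfolding Q_def using ys by (intro exI[of _ "y # ys"]) auto
    then show False using n(2) by fastforce
  qed
  then have "K \<subseteq> alg_span k (set ys)"
    using alg algebraic_over_mono alg_span_closed unfolding alg_elements_def by blast
  also have "\<dots> \<subseteq> alg_span k (insert t (set ys))" by (rule alg_span_mono) blast
  finally have "field_adjoin K {t} \<subseteq> alg_span k (insert t (set ys))"
    using alg_span_superset[of k "insert t (set ys)"] by (intro field_adjoin_minimal subfield_alg_span) auto
  then have span: "alg_span k (insert t (set ys)) = UNIV" using gen by blast
  have "set ys \<subseteq> \<rho> ` (K' \<inter> V)" using ys(1) unfolding residues_def .
  then have "\<exists>zs. set zs \<subseteq> K' \<inter> V \<and> map \<rho> zs = ys"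
  proof (induction ys)
    case (Cons y ys)
    then obtain zs z where "set zs \<subseteq> K' \<inter> V" "map \<rho> zs = ys" "z \<in> K' \<inter> V" "y = \<rho> z" by auto
    then show ?case by (intro exI[of _ "z # zs"]) auto
  qed simp
  then obtain zs where zs: "set zs \<subseteq> K'" "set zs \<subseteq> V" "map \<rho> zs = ys" by blast
  have kV: "k \<subseteq> V" "\<rho> ` k \<subseteq> k" using k K by auto
  have lift: "alg_indep_list k zs" "field_adjoin k (set zs) \<subseteq> V"
    using alg_indep_list_lift[OF k(1) kV zs(2)] zs(3) ys(2) by auto
  have "\<not> algebraic_over (field_adjoin k (set zs)) b"
    using transcendental_of_zero_residue[OF subfield_field_adjoin lift(2) b(2,4,3)] .
  moreover have "field_adjoin k (set (b # zs)) \<subseteq> K'"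
    using zs(1) b(1) k(3) by (intro field_adjoin_minimal K') auto
  then have "\<not> algebraic_over (field_adjoin k (set (b # zs))) t'"
    using t' algebraic_over_mono by blast
  ultimately have "alg_indep_list k (t' # b # zs)"
    using lift(1) by (simp add: alg_span_def alg_elements_def)
  then have "length (t' # b # zs) \<le> card (insert t (set ys))"
    using alg_indep_length_le[OF _ _ span] by blast
  also have "\<dots> \<le> Suc (length ys)" using card_insert_le_m1 card_length
    by (metis card_insert_if finite_set Suc_le_mono le_SucI)
  also have "length ys = length zs" using zs(3) by auto
  finally show False by simp
qed

section \<open>Two coefficient fields of one rational function field\<close>

text \<open>
  The place at \<open>t = \<infinity>\<close>, which is the place at zero in the variable \<open>u = 1/t\<close>, is the identity on \<open>K\<close> and
  has a pole at \<open>a\<close>, a polynomial in \<open>t\<close> of positive degree. It is therefore nontrivial on \<open>K'\<close>, and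
  \<open>residue_field_not_algebraic\<close> supplies the transcendental residue that the ruled residue theorem
  requires.
\<close>

lemma coefficient_field_ruled:
  fixes K K' :: "'a::field set"
  assumes K: "is_subfield K" "\<not> algebraic_over K t" "field_adjoin K {t} = UNIV"
    and K': "is_subfield K'" "\<not> algebraic_over K' t'" "field_adjoin K' {t'} = UNIV"
    and k: "is_subfield k" "k \<subseteq> K" "k \<subseteq> K'"
    and fin: "finite S" "alg_span k S = UNIV"
    and a: "a \<in> K'" "a \<in> ring_adjoin K t" "a \<notin> K"
  shows "ruled_over k K"
proof -
  note R = subfield_subring[OF K(1)]
  define u where "u = inverse t"
  have "t \<noteq> 0" using K(2) algebraic_over_self[OF R subring_0[OF R]] by auto
  have "\<not> algebraic_over K u" using K(2) algebraic_over_inverse[of K u] by (auto simp: u_def)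
  moreover have "field_adjoin K {u} = UNIV"
  proof -
    have "inverse u \<in> field_adjoin K {u}"
      using field_adjoin_superset[of K "{u}"] by (intro subfield_inverse[OF subfield_field_adjoin]) auto
    then have "field_adjoin K {t} \<subseteq> field_adjoin K {u}"
      using field_adjoin_superset[of K "{u}"]
      by (intro field_adjoin_minimal subfield_field_adjoin) (auto simp: u_def)
    then show ?thesis using K(3) by blast
  qed
  ultimately obtain V \<rho> where pl: "field_place V \<rho>" and image: "\<rho> ` V \<subseteq> K"
    and val: "\<And>p q. p \<in> polys_over K \<Longrightarrow> q \<in> polys_over K \<Longrightarrow> coeff q 0 \<noteq> 0 \<Longrightarrow>
       poly p u / poly q u \<in> V \<and> \<rho> (poly p u / poly q u) = coeff p 0 / coeff q 0"
    using place_at_zero[OF K(1)] by blast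
  interpret field_place V \<rho> by (rule pl)
  have id: "c \<in> V \<and> \<rho> c = c" if "c \<in> K" for c
    using val[OF const_polys_over[OF R that] subring_1[OF subring_polys_over[OF R]]] by simp
  then have "K \<subseteq> V" "K \<subseteq> \<rho> ` V" by (auto intro!: image_eqI[where f = \<rho>])
  then have KV: "K \<subseteq> V" "\<rho> ` V = K" using image by auto
  obtain p where p: "p \<in> polys_over K" "a = poly p t" using a(2) by (rule ring_adjoinE)
  have "degree p \<noteq> 0"
  proof
    assume "degree p = 0"
    then have "a = coeff p 0" using p(2) by (metis degree_eq_zeroE coeff_pCons_0 poly_const_conv)
    then show False using a(3) polys_overD[OF p(1)] by simp
  qed
  have "a \<noteq> 0" using a(3) subring_0[OF R] by auto
  have reflected: "poly (reflect_poly p) u = u ^ degree p * a"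
    using poly_reflect_poly_nz[of u p] \<open>t \<noteq> 0\<close> p(2) by (simp add: u_def)
  have "u \<noteq> 0" using \<open>t \<noteq> 0\<close> by (simp add: u_def)
  \<comment> \<open>Multiplying \<open>p(t)\<close> by \<open>u ^ degree p\<close> reverses its coefficients, so the denominator has the
      leading coefficient of \<open>p\<close> as constant term.\<close>
  have "inverse a = poly (monom 1 (degree p)) u / poly (reflect_poly p) u"
    using \<open>u \<noteq> 0\<close> unfolding reflected by (simp add: poly_monom field_simps)
  moreover have "reflect_poly p \<in> polys_over K"
    using polys_overD[OF p(1)] subring_0[OF R] by (intro polys_overI) (simp add: coeff_reflect_poly)
  moreover have "coeff (reflect_poly p) 0 \<noteq> 0" using \<open>degree p \<noteq> 0\<close> by auto
  moreover have "coeff (monom (1::'a) (degree p)) 0 = 0" using \<open>degree p \<noteq> 0\<close> by simp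
  ultimately have b: "inverse a \<in> V" "\<rho> (inverse a) = 0"
    using val[OF monom_polys_over[OF R subring_1[OF R]], of "reflect_poly p" "degree p"] by simp_all
  obtain c where c: "c \<in> K" "c \<notin> alg_elements (residues K')"
    using residue_field_not_algebraic[OF pl K(1) KV(1) _ K(3) K'(1,2) k fin
        subfield_inverse[OF K'(1) a(1)] b(1) _ b(2)] id \<open>a \<noteq> 0\<close> by auto
  define D where "D = K \<inter> alg_elements (residues K')"
  obtain r where r: "\<not> algebraic_over D r" "K = field_adjoin D {r}"
    using ruled_residue_field[OF K'(1,3), of c] c id KV(2) unfolding D_def by auto
  have sub: "is_subfield (alg_elements (residues K'))"
    by (intro subfield_alg_elements subfield_residues K'(1))
  have D: "is_subfield D"
    using K(1) sub unfolding D_def is_subfield_def is_subring_def by auto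
  have "k \<subseteq> residues K'"
    unfolding residues_def using k id by (intro subsetI image_eqI[where f = \<rho>]) auto
  then have "k \<subseteq> D"
    unfolding D_def using k(2) alg_elements_base[OF subfield_residues[OF K'(1)]] by blast
  then show ?thesis
    unfolding ruled_over_def using D purely_transcendental_1[OF D r(1)] r(2) D_def by (metis inf_le1)
qed

text \<open>
  Over \<open>K'\<close> the whole field has transcendence degree at most \<open>1\<close>, while \<open>x \<in> K\<close> transcendental over \<open>K'\<close>
  would make \<open>x, t\<close> independent.
\<close>

lemma coefficient_fields_antisym:
  fixes K K' :: "'a::field set"
  assumes K: "is_subfield K" "\<not> algebraic_over K t"
    and K': "is_subfield K'" "field_adjoin K' {t'} = UNIV" and "K' \<subseteq> K"
  shows "K \<subseteq> alg_elements K'"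
proof
  fix x assume x: "x \<in> K"
  show "x \<in> alg_elements K'"
  proof (rule ccontr)
    assume "x \<notin> alg_elements K'"
    have eq: "alg_span K' {} = alg_elements K'"
      unfolding alg_span_def
      using field_adjoin_minimal[OF K'(1), of K' "{}"] field_adjoin_superset[of K' "{}"] by auto
    have "x \<notin> alg_span K' {}" using \<open>x \<notin> alg_elements K'\<close> eq by simp
    moreover have "t \<notin> alg_span K' {x}"
      using K x \<open>K' \<subseteq> K\<close> algebraic_over_mono[of "field_adjoin K' {x}" t K]
        field_adjoin_minimal[OF K(1), of K' "{x}"] by (auto simp: alg_span_def alg_elements_def)
    ultimately have "alg_indep_list K' [t, x]" by simp
    moreover have "alg_span K' {t'} = UNIV"
      using K'(2) alg_elements_base[OF subfield_field_adjoin, of K' "{t'}"] unfolding alg_span_def by auto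
    ultimately show False using alg_indep_length_le[of K' "[t, x]" "{t'}"] by simp
  qed
qed

section \<open>The subrings in the set of the theorem\<close>

lemma Frac_quotients: "Frac A = quotients (to_fract ` A)"
proof (intro equalityI subsetI)
  fix x assume "x \<in> Frac A"
  then obtain m s where "x = to_fract m / to_fract s" "m \<in> A" "s \<in> A" "s \<noteq> 0"
    unfolding Frac_def fractions_def by blast
  then show "x \<in> quotients (to_fract ` A)" by (auto intro!: quotientsI)
next
  fix x assume "x \<in> quotients (to_fract ` A)"
  then obtain m s where "x = to_fract m / to_fract s" "m \<in> A" "s \<in> A" "to_fract s \<noteq> 0"
    by (blast elim: quotientsE)
  then have "x = to_fract m / to_fract s" "m \<in> A" "s \<in> A - {0}" by auto
  then show "x \<in> Frac A" unfolding Frac_def fractions_def by blast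
qed

lemma subring_to_fract: "is_subring A \<Longrightarrow> is_subring (to_fract ` A)"
  unfolding is_subring_def
  by (auto simp flip: to_fract_diff to_fract_mult) (metis image_eqI to_fract_1)

lemma polys_over_to_fract:
  assumes "p \<in> polys_over (to_fract ` A)" "0 \<in> A"
  shows "\<exists>q\<in>polys_over A. p = map_poly to_fract q"
  using assms(1)
proof (induction p)
  case 0
  then show ?case using assms(2) by (intro bexI[of _ 0]) (auto simp: polys_over_def)
next
  case (pCons a p)
  have "p \<in> polys_over (to_fract ` A)"
    using pCons.prems pCons_polys_overD by blast
  then obtain q where q: "q \<in> polys_over A" "p = map_poly to_fract q" using pCons.IH by blast
  have "a \<in> to_fract ` A" using polys_overD[OF pCons.prems, of 0] by simp
  then obtain b where "b \<in> A" "a = to_fract b" by blast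
  then show ?case
    using q by (intro bexI[of _ "pCons b q"] pCons_polys_over) (auto simp: map_poly_pCons)
qed

lemma poly_map_to_fract: "poly (map_poly to_fract q) (to_fract x) = to_fract (poly q x)"
  by (induction q) (simp_all add: map_poly_pCons)

text \<open>
  Denominators in an equation over \<open>Frac A\<close> can be cleared, so \<open>x\<close> is algebraic over \<open>A\<close>.
\<close>

lemma algebraically_closed_contraction:
  assumes A: "is_subring A" "algebraically_closed_in A UNIV" and "to_fract x \<in> alg_elements (Frac A)"
  shows "x \<in> A"
proof -
  have "algebraic_over (to_fract ` A) (to_fract x)"
    using assms(3) algebraic_over_quotients[OF subring_to_fract[OF A(1)]]
    unfolding Frac_quotients alg_elements_def by blast
  then obtain p where p: "p \<in> polys_over (to_fract ` A)" "p \<noteq> 0" "poly p (to_fract x) = 0"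
    unfolding algebraic_over_iff by blast
  obtain q where q: "q \<in> polys_over A" "p = map_poly to_fract q"
    using polys_over_to_fract[OF p(1) subring_0[OF A(1)]] by blast
  have "q \<noteq> 0" using p(2) q(2) by auto
  moreover have "poly q x = 0" using p(3) q(2) by (simp add: poly_map_to_fract)
  ultimately have "algebraic_over A x" using q(1) unfolding algebraic_over_iff by blast
  then show ?thesis using A(2) unfolding algebraically_closed_in_def by blast
qed

lemma A1_starE:
  assumes "A \<in> A1_star"
  obtains t where "is_subfield (Frac A)" "\<not> algebraic_over (Frac A) t"
    "range to_fract \<subseteq> ring_adjoin (Frac A) t" "field_adjoin (Frac A) {t} = UNIV"
proof -
  have A: "is_subring A" "is_poly_ring_over (Frac A) (fractions (A - {0}) UNIV)"
    using assms unfolding A1_star_def by auto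
  have K: "is_subfield (Frac A)"
    unfolding Frac_quotients by (rule subfield_quotients[OF subring_to_fract[OF A(1)]])
  obtain t where t: "\<not> algebraic_over (Frac A) t"
      "fractions (A - {0}) UNIV = ring_adjoin (Frac A) t"
    using A(2) unfolding is_poly_ring_over_def ring_adjoin_def polys_over_def by auto
  have incl: "to_fract x \<in> ring_adjoin (Frac A) t" for x
  proof -
    have "to_fract x / to_fract 1 \<in> fractions (A - {0}) UNIV"
      unfolding fractions_def using subring_1[OF A(1)]
      by (intro CollectI exI[of _ x] exI[of _ 1]) auto
    then show ?thesis using t(2) by simp
  qed
  have "y \<in> field_adjoin (Frac A) {t}" for y
  proof (cases y)
    case (Fract a b)
    then have "y = to_fract a / to_fract b" by (simp add: Fract_conv_to_fract)
    then show ?thesis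
      unfolding field_adjoin_single[OF K] using incl Fract by (auto intro!: quotientsI)
  qed
  then show thesis using that[OF K t(1)] incl by blast
qed

lemma A1_star_antisym:
  assumes A: "A \<in> A1_star" and A': "A' \<in> A1_star" and "A' \<subseteq> A"
  shows "A' = A"
proof
  obtain t where t: "is_subfield (Frac A)" "\<not> algebraic_over (Frac A) t" using A1_starE[OF A] .
  obtain t' where t': "is_subfield (Frac A')" "field_adjoin (Frac A') {t'} = UNIV" using A1_starE[OF A'] .
  have "is_subring A" "is_subring A'" and closed: "algebraically_closed_in A' UNIV"
    using A A' unfolding A1_star_def by auto
  have "Frac A' \<subseteq> Frac A" unfolding Frac_quotients quotients_def using \<open>A' \<subseteq> A\<close> by blast
  then have "Frac A \<subseteq> alg_elements (Frac A')" using coefficient_fields_antisym[OF t t'] by blast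
  moreover have "to_fract ` A \<subseteq> Frac A"
    unfolding Frac_quotients by (rule quotients_base[OF subring_to_fract[OF \<open>is_subring A\<close>]])
  ultimately show "A \<subseteq> A'"
    using algebraically_closed_contraction[OF \<open>is_subring A'\<close> closed] by blast
qed (rule assms(3))

text \<open>
  In \<open>K[t]\<close>, with \<open>K = Frac A\<close>, only constants are invertible, so a unit of \<open>B\<close> lies in \<open>K\<close>.
\<close>

lemma unit_mem_A1_star:
  assumes A: "A \<in> A1_star" and u: "u * w = (1 :: 'b :: idom)"
  shows "u \<in> A"
proof -
  obtain t where t: "is_subfield (Frac A)" "\<not> algebraic_over (Frac A) t"
      "range to_fract \<subseteq> ring_adjoin (Frac A) t" using A1_starE[OF A] .
  note P = subring_polys_over[OF subfield_subring[OF t(1)]]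
  obtain p q where pq: "p \<in> polys_over (Frac A)" "to_fract u = poly p t"
      "q \<in> polys_over (Frac A)" "to_fract w = poly q t"
    using t(3) by (metis rangeI subsetD ring_adjoinE)
  have "poly p t * poly q t = to_fract (u * w)" using pq by simp
  then have "poly (p * q - 1) t = 0" using u by simp
  moreover have "p * q - 1 \<in> polys_over (Frac A)"
    using pq by (intro subring_diff[OF P] subring_mult[OF P] subring_1[OF P])
  ultimately have "p * q = 1" using t(2) unfolding algebraic_over_iff by auto
  then have "degree p = 0" by (metis dvd_triv_left is_unit_poly_iff degree_pCons_0)
  then have "to_fract u \<in> Frac A"
    using pq(1,2) polys_overD[OF pq(1), of 0] by (metis coeff_pCons_0 degree_eq_zeroE poly_const_conv)
  then have "to_fract u \<in> alg_elements (Frac A)" using alg_elements_base[OF t(1)] by blast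
  then show ?thesis using algebraically_closed_contraction A unfolding A1_star_def by blast
qed

text \<open>
  An infimum below \<open>\<infinity>\<close> is witnessed by a finite transcendence basis.
\<close>

lemma finite_alg_span_of_trdeg:
  assumes "trdeg k (UNIV :: 'a::field set) < \<infinity>"
  shows "\<exists>S. finite S \<and> alg_span k S = UNIV"
proof -
  have "\<exists>X. transcendence_basis k UNIV X \<and> finite X"
  proof (rule ccontr)
    assume no: "\<not> ?thesis"
    have "\<infinity> \<le> trdeg k (UNIV :: 'a set)" unfolding trdeg_def by (rule INF_greatest) (use no in auto)
    then show False using assms by simp
  qed
  then show ?thesis unfolding transcendence_basis_def alg_span_def alg_elements_def by blast
qed

theorem proposition2p2:
  fixes \<phi> :: "'k :: field \<Rightarrow> 'b :: idom"
    and k :: "'b set"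
    and kF :: "'b fract set"
  assumes "\<phi> 1 = 1"
    and "\<And>x y. \<phi> (x + y) = \<phi> x + \<phi> y"
    and "\<And>x y. \<phi> (x * y) = \<phi> x * \<phi> y"
    and k_def: "k = range \<phi>"
    and kF_def: "kF = to_fract ` k"
    and "trdeg kF (UNIV :: 'b fract set) < \<infinity>"
    and "\<exists>A\<in>A1_star. \<exists>A'\<in>(A1_star :: 'b set set). A \<noteq> A'"
  shows "(\<forall>A\<in>A1_star. k \<subseteq> A \<and> ruled_over kF (Frac A)) \<and>
         (\<exists>K. is_subfield K \<and> kF \<subseteq> K \<and> K \<subseteq> UNIV \<and> purely_transcendental K 2 (UNIV :: 'b fract set))"
proof -
  have \<phi>_0: "\<phi> 0 = 0" using assms(2)[of 0 0] by (metis add.right_neutral add_cancel_left_right)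
  have \<phi>_diff: "\<phi> (x - y) = \<phi> x - \<phi> y" for x y using assms(2)[of "x - y" y] by simp
  have \<phi>_inv: "\<phi> x * \<phi> (inverse x) = 1" if "x \<noteq> 0" for x
    using assms(1) assms(3)[of x "inverse x"] that by simp
  have k: "is_subring k"
    unfolding is_subring_def k_def using assms(1,3) \<phi>_diff by (metis rangeE rangeI)
  have sub: "is_subfield kF"
    unfolding is_subfield_def
  proof (intro conjI ballI)
    show "is_subring kF" unfolding kF_def by (rule subring_to_fract[OF k])
    fix y assume "y \<in> kF"
    then obtain x where x: "y = to_fract (\<phi> x)" unfolding kF_def k_def by blast
    show "inverse y \<in> kF"
    proof (cases "x = 0")
      case True
      then show ?thesis using \<open>y \<in> kF\<close> x \<phi>_0 by simp
    next
      case False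
      have "y * to_fract (\<phi> (inverse x)) = 1" using \<phi>_inv[OF False] x by (simp flip: to_fract_mult)
      then have "inverse y = to_fract (\<phi> (inverse x))" by (rule inverse_unique)
      then show ?thesis unfolding kF_def k_def by blast
    qed
  qed
  have k_sub: "k \<subseteq> A" if "A \<in> A1_star" for A
  proof
    fix y assume "y \<in> k"
    then obtain x where x: "y = \<phi> x" unfolding k_def by blast
    show "y \<in> A"
    proof (cases "x = 0")
      case True
      then show ?thesis using x \<phi>_0 that subring_0 unfolding A1_star_def by auto
    next
      case False
      show ?thesis using unit_mem_A1_star[OF that \<phi>_inv[OF False]] x by simp
    qed
  qed
  have kF_sub: "kF \<subseteq> Frac A" if A: "A \<in> A1_star" for A
  proof -
    have "is_subring A" using A unfolding A1_star_def by simp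
    then have "to_fract ` A \<subseteq> Frac A" unfolding Frac_quotients by (intro quotients_base subring_to_fract)
    then show ?thesis unfolding kF_def using k_sub[OF A] by blast
  qed
  obtain S where S: "finite S" "alg_span kF S = UNIV" using finite_alg_span_of_trdeg[OF assms(6)] by blast
  have ruled: "ruled_over kF (Frac A)" if A: "A \<in> A1_star" for A
  proof -
    obtain A' where A': "A' \<in> A1_star" "A' \<noteq> A" using assms(7) by metis
    then obtain a where a: "a \<in> A'" "a \<notin> A" using A1_star_antisym[OF A] by blast
    obtain t where t: "is_subfield (Frac A)" "\<not> algebraic_over (Frac A) t"
        "range to_fract \<subseteq> ring_adjoin (Frac A) t" "field_adjoin (Frac A) {t} = UNIV" using A1_starE[OF A] .
    obtain t' where t': "is_subfield (Frac A')" "\<not> algebraic_over (Frac A') t'"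
        "field_adjoin (Frac A') {t'} = UNIV" using A1_starE[OF A'(1)] .
    have "is_subring A'" using A' unfolding A1_star_def by simp
    then have "to_fract a \<in> Frac A'"
      unfolding Frac_quotients using quotients_base[OF subring_to_fract] a(1) by blast
    moreover have "to_fract a \<notin> Frac A"
      using algebraically_closed_contraction[of A a] A a(2) alg_elements_base[OF t(1)]
      unfolding A1_star_def by blast
    ultimately show ?thesis
      using coefficient_field_ruled[OF t(1,2,4) t' sub kF_sub[OF A] kF_sub[OF A'(1)] S] t(3) by blast
  qed
  obtain A where A: "A \<in> (A1_star :: 'b set set)" using assms(7) by blast
  obtain F where F: "is_subfield F" "kF \<subseteq> F" "purely_transcendental F 1 (Frac A)"
    using ruled[OF A] unfolding ruled_over_def by blast
  obtain t where t: "\<not> algebraic_over (Frac A) t" "field_adjoin (Frac A) {t} = UNIV" using A1_starE[OF A] .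
  have "purely_transcendental F 2 (UNIV :: 'b fract set)"
    using purely_transcendental_Suc[OF F(1,3) t(1)] t(2) by (simp add: numeral_2_eq_2)
  then show ?thesis using k_sub ruled F by blast
qed

end
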